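(* Let $(x,u)\in\Gamma_\tau$ and suppose that there exists a system $(A_s,B_s)\in\Sigma_{n,m}$ (the true system) such that $x'(t)=A_sx(t)+B_su(t)$ for a.e. $t\in[0,\tau]$. Let $(X_{\mathrm d},X,U)$ be the synthesis operator triple associated with $(x,u)$. Then the following statements are equivalent: (i) The data $(x,u)$ are informative for system identification. (ii) $\operatorname{Ran}\begin{bmatrix} X \\ U \end{bmatrix}=\mathbb{R}^{n+m}$. (iii) The matrix $\begin{bmatrix} XX^* & XU^* \\ U X^* & U U^* \end{bmatrix}\in\mathbb{R}^{(n+m)\times(n+m)}$ is invertible. Furthermore, if statement (iii) holds, then the true system $(A_s,B_s)$ is given by $$\begin{bmatrix}A_s&B_s\end{bmatrix}=\begin{bmatrix}X_{\mathrm d}X^*&X_{\mathrm d}U^*\end{bmatrix}\begin{bmatrix} XX^* & XU^* \\ U X^* & U U^* \end{bmatrix}^{-1}.$$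
   Context: Fix $\tau>0$ and positive integers $n,m$. $\mathrm{L}^2([0,\tau];\mathbb{R}^n)$ is the space of (classes of) square-integrable measurable functions $[0,\tau]\to\mathbb{R}^n$; $\mathrm{H}^1([0,\tau];\mathbb{R}^n)$ is the space of absolutely continuous functions $\phi:[0,\tau]\to\mathbb{R}^n$ with $\phi'\in\mathrm{L}^2([0,\tau];\mathbb{R}^n)$; $\mathrm{H}^1_0[0,\tau]$ is the space of scalar functions $\phi\in \mathrm{H}^1([0,\tau];\mathbb{R})$ with $\phi(0)=\phi(\tau)=0$, a Hilbert space with inner product $\langle\phi,\psi\rangle_{\mathrm{H}^1_0}=\int_0^\tau\phi'(t)\psi'(t)\,dt$. $\Gamma_\tau=\{(x,u): x\in\mathrm{H}^1([0,\tau];\mathbb{R}^n),\ u\in\mathrm{L}^2([0,\tau];\mathbb{R}^m)\}$ and $\Sigma_{n,m}=\{(A,B):A\in\mathbb{R}^{n\times n},\ B\in\mathbb{R}^{n\times m}\}$. For $f\in\mathrm{L}^2([0,\tau];\mathbb{R}^k)$, the synthesis operator $F$ and the differentiated synthesis operator $F_{\mathrm d}$ associated with $f$ are the bounded linear operators $\mathrm{H}^1_0[0,\tau]\to\mathbb{R}^k$ given by $F\phi=\int_0^\tau\phi(t)f(t)\,dt$ and $F_{\mathrm d}\phi=-\int_0^\tau\phi'(t)f(t)\,dt$. For $(x,u)\in\Gamma_\tau$, the synthesis operator triple $(X_{\mathrm d},X,U)$ associated with $(x,u)$ consists of the differentiated synthesis operator $X_{\mathrm d}$ associated with $x$, the synthesis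 operator $X$ associated with $x$, and the synthesis operator $U$ associated with $u$. The operator $\begin{bmatrix} X \\ U \end{bmatrix}:\mathrm{H}^1_0[0,\tau]\to\mathbb{R}^{n+m}$ maps $\phi$ to $(X\phi,U\phi)$. $T^*$ denotes the Hilbert space adjoint (with respect to $\langle\cdot,\cdot\rangle_{\mathrm{H}^1_0}$ and the Euclidean inner product); products such as $XX^*$, $XU^*$, $X_{\mathrm d}U^*$ are linear maps between Euclidean spaces and are identified with matrices. $\operatorname{Ran}$ denotes the range. For $\mathfrak{D}=(x,u)\in\Gamma_\tau$, $\Sigma_{\mathfrak{D}}=\{(A,B)\in\Sigma_{n,m}: x'=Ax+Bu \text{ a.e. on }[0,\tau]\}$. When a true system $(A_s,B_s)$ as in the claim exists, the data $\mathfrak{D}=(x,u)$ are called informative for system identification if $\Sigma_{\mathfrak{D}}=\{(A_s,B_s)\}$. *)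

theory Defs
  imports "HOL-Analysis.Analysis"
begin

section \<open>Function spaces on the interval from 0 to tau\<close>

text \<open>
  Elements of the function spaces are represented by functions on all of \<open>real\<close>. Square-integrable
  classes are represented by their members; everything below depends on such a function only through
  its values almost everywhere on \<open>{0..\<tau>}\<close>.
\<close>

definition L2 :: "real \<Rightarrow> (real \<Rightarrow> 'a::euclidean_space) set" where
  "L2 \<tau> = {f. f \<in> borel_measurable (lebesgue_on {0..\<tau>}) \<and>
              integrable (lebesgue_on {0..\<tau>}) (\<lambda>t. (norm (f t))\<^sup>2)}"

text \<open>
  Absolute continuity of a function (the library's \<open>absolutely_continuous\<close> is about measures).
  The family \<open>D\<close> ranges over the finite families of non-overlapping compact subintervals
  \<open>[c, d]\<close> of \<open>[a, b]\<close>, with \<open>Inf K = c\<close> and \<open>Sup K = d\<close>.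
\<close>

definition abs_continuous_on :: "real \<Rightarrow> real \<Rightarrow> (real \<Rightarrow> 'a::real_normed_vector) \<Rightarrow> bool" where
  "abs_continuous_on a b f \<longleftrightarrow>
     (\<forall>\<epsilon>>0. \<exists>\<delta>>0. \<forall>D S. D division_of S \<and> S \<subseteq> {a..b} \<and> (\<Sum>K\<in>D. Sup K - Inf K) < \<delta> \<longrightarrow>
        (\<Sum>K\<in>D. norm (f (Sup K) - f (Inf K))) < \<epsilon>)"

definition derivative_on :: "real \<Rightarrow> (real \<Rightarrow> 'a::real_normed_vector) \<Rightarrow> real \<Rightarrow> 'a" where
  "derivative_on \<tau> \<phi> t = vector_derivative \<phi> (at t within {0..\<tau>})"

text \<open>
  An absolutely continuous function is differentiable almost everywhere, so the second conjunct
  is no restriction; it is spelled out because \<open>vector_derivative\<close> is a total function.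
\<close>

definition H1 :: "real \<Rightarrow> (real \<Rightarrow> 'a::euclidean_space) set" where
  "H1 \<tau> = {\<phi>. abs_continuous_on 0 \<tau> \<phi> \<and>
              (AE t in lebesgue_on {0..\<tau>}. \<phi> differentiable (at t within {0..\<tau>})) \<and>
              derivative_on \<tau> \<phi> \<in> L2 \<tau>}"

text \<open>
  Functions in \<open>H10 \<tau>\<close> are extended by zero outside \<open>{0..\<tau>}\<close>, so that each element of the Hilbert
  space has exactly one representative.
\<close>

definition H10 :: "real \<Rightarrow> (real \<Rightarrow> real) set" where
  "H10 \<tau> = {\<phi>. \<phi> \<in> H1 \<tau> \<and> \<phi> 0 = 0 \<and> \<phi> \<tau> = 0 \<and> (\<forall>t. t \<notin> {0..\<tau>} \<longrightarrow> \<phi> t = 0)}"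

definition H10_inner :: "real \<Rightarrow> (real \<Rightarrow> real) \<Rightarrow> (real \<Rightarrow> real) \<Rightarrow> real" where
  "H10_inner \<tau> \<phi> \<psi> = (LINT t|lebesgue_on {0..\<tau>}. derivative_on \<tau> \<phi> t * derivative_on \<tau> \<psi> t)"

text \<open>
  Hilbert space adjoint of an operator from \<open>H10 \<tau>\<close>, which is a carrier set and not a type, so that
  the library's \<open>adjoint\<close> does not apply. For bounded linear \<open>T\<close> the described element exists and is
  unique by the Riesz representation theorem.
\<close>

definition H10_adjoint ::
  "real \<Rightarrow> ((real \<Rightarrow> real) \<Rightarrow> 'b::real_inner) \<Rightarrow> 'b \<Rightarrow> (real \<Rightarrow> real)" where
  "H10_adjoint \<tau> T v = (THE \<psi>. \<psi> \<in> H10 \<tau> \<and> (\<forall>\<phi>\<in>H10 \<tau>. T \<phi> \<bullet> v = H10_inner \<tau> \<phi> \<psi>))"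


section \<open>Synthesis operators\<close>

definition synthesis :: "real \<Rightarrow> (real \<Rightarrow> real ^ 'k) \<Rightarrow> (real \<Rightarrow> real) \<Rightarrow> real ^ 'k" where
  "synthesis \<tau> f \<phi> = (LINT t|lebesgue_on {0..\<tau>}. \<phi> t *\<^sub>R f t)"

definition synthesis_d :: "real \<Rightarrow> (real \<Rightarrow> real ^ 'k) \<Rightarrow> (real \<Rightarrow> real) \<Rightarrow> real ^ 'k" where
  "synthesis_d \<tau> f \<phi> = - (LINT t|lebesgue_on {0..\<tau>}. derivative_on \<tau> \<phi> t *\<^sub>R f t)"

text \<open>The matrix of \<open>S T\<^sup>*\<close>.\<close>

definition mult_adjoint ::
  "real \<Rightarrow> ((real \<Rightarrow> real) \<Rightarrow> real ^ 'p) \<Rightarrow> ((real \<Rightarrow> real) \<Rightarrow> real ^ 'q) \<Rightarrow> real ^ 'q ^ 'p" where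
  "mult_adjoint \<tau> S T = matrix (\<lambda>v. S (H10_adjoint \<tau> T v))"


section \<open>Block vectors and matrices\<close>

text \<open>
  The index type \<open>'n + 'm\<close> has \<open>CARD('n) + CARD('m)\<close> elements. As a matrix is a vector of rows,
  \<open>stack\<close> also places one matrix on top of another.
\<close>

definition stack :: "'a ^ 'n \<Rightarrow> 'a ^ 'm \<Rightarrow> 'a ^ ('n + 'm)" where
  "stack v w = (\<chi> i. case i of Inl j \<Rightarrow> v $ j | Inr k \<Rightarrow> w $ k)"

definition beside :: "'a ^ 'n ^ 'k \<Rightarrow> 'a ^ 'm ^ 'k \<Rightarrow> 'a ^ ('n + 'm) ^ 'k" where
  "beside P Q = (\<chi> i. stack (P $ i) (Q $ i))"

definition block_matrix ::
  "'a ^ 'n ^ 'k \<Rightarrow> 'a ^ 'm ^ 'k \<Rightarrow> 'a ^ 'n ^ 'l \<Rightarrow> 'a ^ 'm ^ 'l \<Rightarrow> 'a ^ ('n + 'm) ^ ('k + 'l)" where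
  "block_matrix P Q R S = stack (beside P Q) (beside R S)"


section \<open>Data and systems\<close>

definition data_space :: "real \<Rightarrow> ((real \<Rightarrow> real ^ 'n) \<times> (real \<Rightarrow> real ^ 'm)) set" where
  "data_space \<tau> = H1 \<tau> \<times> L2 \<tau>"

definition satisfies_system ::
  "real \<Rightarrow> (real \<Rightarrow> real ^ 'n) \<Rightarrow> (real \<Rightarrow> real ^ 'm) \<Rightarrow> real ^ 'n ^ 'n \<Rightarrow> real ^ 'm ^ 'n \<Rightarrow> bool" where
  "satisfies_system \<tau> x u A B \<longleftrightarrow>
     (AE t in lebesgue_on {0..\<tau>}. derivative_on \<tau> x t = A *v x t + B *v u t)"

definition consistent_systems ::
  "real \<Rightarrow> (real \<Rightarrow> real ^ 'n) \<Rightarrow> (real \<Rightarrow> real ^ 'm) \<Rightarrow> ((real ^ 'n ^ 'n) \<times> (real ^ 'm ^ 'n)) set" where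
  "consistent_systems \<tau> x u = {(A, B). satisfies_system \<tau> x u A B}"

definition informative_for_identification ::
  "real \<Rightarrow> (real \<Rightarrow> real ^ 'n) \<Rightarrow> (real \<Rightarrow> real ^ 'm) \<Rightarrow> real ^ 'n ^ 'n \<Rightarrow> real ^ 'm ^ 'n \<Rightarrow> bool" where
  "informative_for_identification \<tau> x u A\<^sub>s B\<^sub>s \<longleftrightarrow> consistent_systems \<tau> x u = {(A\<^sub>s, B\<^sub>s)}"

end

theory Submission
  imports Defs
begin

text \<open>
  Put \<open>f t = stack (x t) (u t)\<close> and let \<open>S = synthesis \<tau> f\<close>, which is the operator \<open>(X, U)\<close>. The
  Gram matrix in the third condition is the matrix of \<open>S S\<^sup>*\<close>, and the second and third conditions say
  that \<open>S\<close> is onto, respectively that \<open>S S\<^sup>*\<close> is invertible. These are equivalent because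
  \<open>S S\<^sup>*\<close> maps into the range of \<open>S\<close>, and because \<open>S S\<^sup>* v = 0\<close> gives \<open>S\<^sup>* v = 0\<close>, that is, \<open>v\<close> is
  orthogonal to the range of \<open>S\<close> (\<open>surj_synthesis_iff_invertible\<close>).

  The link to the differential equation is integration by parts: test functions vanish at both end
  points, so \<open>X\<^sub>d \<phi> = - \<integral> \<phi>' x = \<integral> \<phi> x'\<close>, and every system \<open>(A, B)\<close> that explains the data satisfies
  \<open>X\<^sub>d = [A B] S\<close> (\<open>satisfies_system_imp_synthesis_d\<close>). If \<open>S\<close> is onto, this determines \<open>[A B]\<close>;
  composing with \<open>S\<^sup>*\<close> gives \<open>X\<^sub>d S\<^sup>* = [A B] S S\<^sup>*\<close>, which is the formula for the true system. If \<open>S\<close>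
  is not onto, some \<open>v \<noteq> 0\<close> is orthogonal to its range, so \<open>\<integral> \<phi> (f \<bullet> v) = 0\<close> for all test functions
  \<open>\<phi>\<close>, hence \<open>f \<bullet> v = 0\<close> almost everywhere by the fundamental lemma of the calculus of variations
  (\<open>fundamental_lemma_H10\<close>); adding \<open>v\<close> to every row of \<open>[A B]\<close> then gives another system that
  explains the data (\<open>informative_iff_surj\<close>).

  The adjoint is made explicit. For square-integrable \<open>g\<close> the boundary value problem \<open>- \<psi>'' = g\<close>,
  \<open>\<psi> 0 = \<psi> \<tau> = 0\<close> is solved by integrating twice, and \<open>\<psi>\<close> represents the functional
  \<open>\<phi> \<mapsto> \<integral> \<phi> g\<close> in the inner product \<open>\<integral> \<phi>' \<psi>'\<close> (\<open>H10_inner_dirichlet_solution\<close>). So \<open>S\<^sup>* v\<close> is the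
  solution for \<open>g = f \<bullet> v\<close> (\<open>H10_adjoint_synthesis\<close>). That absolutely
  continuous functions are the integrals of their derivatives carries the analysis
  (\<open>abs_continuous_on_FTC\<close>).
\<close>

section \<open>Absolutely continuous functions\<close>

lemma abs_continuous_on_subset:
  "abs_continuous_on a b f \<Longrightarrow> {c..d} \<subseteq> {a..b} \<Longrightarrow> abs_continuous_on c d f"
  unfolding abs_continuous_on_def by (meson subset_trans)

lemma abs_continuous_on_add:
  assumes "abs_continuous_on a b f" "abs_continuous_on a b g"
  shows "abs_continuous_on a b (\<lambda>t. f t + g t)"
  unfolding abs_continuous_on_def
proof (intro allI impI)
  fix \<epsilon> :: real assume "\<epsilon> > 0"
  then have e2: "\<epsilon> / 2 > 0" by simp
  obtain \<delta>1 where d1: "\<delta>1 > 0" "\<forall>D S. D division_of S \<and> S \<subseteq> {a..b} \<and> (\<Sum>K\<in>D. Sup K - Inf K) < \<delta>1 \<longrightarrow>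
        (\<Sum>K\<in>D. norm (f (Sup K) - f (Inf K))) < \<epsilon> / 2"
    using assms(1) e2 unfolding abs_continuous_on_def by meson
  obtain \<delta>2 where d2: "\<delta>2 > 0" "\<forall>D S. D division_of S \<and> S \<subseteq> {a..b} \<and> (\<Sum>K\<in>D. Sup K - Inf K) < \<delta>2 \<longrightarrow>
        (\<Sum>K\<in>D. norm (g (Sup K) - g (Inf K))) < \<epsilon> / 2"
    using assms(2) e2 unfolding abs_continuous_on_def by meson
  show "\<exists>\<delta>>0. \<forall>D S. D division_of S \<and> S \<subseteq> {a..b} \<and> (\<Sum>K\<in>D. Sup K - Inf K) < \<delta> \<longrightarrow>
        (\<Sum>K\<in>D. norm (f (Sup K) + g (Sup K) - (f (Inf K) + g (Inf K)))) < \<epsilon>"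
  proof (intro exI[of _ "min \<delta>1 \<delta>2"] conjI allI impI)
    fix D S assume D: "D division_of S \<and> S \<subseteq> {a..b} \<and> (\<Sum>K\<in>D. Sup K - Inf K) < min \<delta>1 \<delta>2"
    have "(\<Sum>K\<in>D. norm (f (Sup K) + g (Sup K) - (f (Inf K) + g (Inf K))))
        \<le> (\<Sum>K\<in>D. norm (f (Sup K) - f (Inf K)) + norm (g (Sup K) - g (Inf K)))"
      by (intro sum_mono norm_diff_triangle_ineq)
    also have "\<dots> < \<epsilon> / 2 + \<epsilon> / 2"
      unfolding sum.distrib using D by (intro add_strict_mono d1(2)[rule_format, of D S] d2(2)[rule_format, of D S]) simp_all
    finally show "(\<Sum>K\<in>D. norm (f (Sup K) + g (Sup K) - (f (Inf K) + g (Inf K)))) < \<epsilon>"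
      by simp
  qed (use d1(1) d2(1) in simp)
qed

lemma division_of_realE:
  fixes K :: "real set"
  assumes "D division_of S" "K \<in> D"
  obtains u v where "u \<le> v" "K = {u..v}" "Sup K = v" "Inf K = u" "{u..v} \<subseteq> S"
proof -
  obtain u v where K: "K = cbox u v" "K \<noteq> {}" "K \<subseteq> S"
    using division_ofD(2-4)[OF assms(1)] assms(2) by metis
  then show ?thesis using that[of u v] by auto
qed

text \<open>
  With \<open>g\<close> the identity this makes Lipschitz functions absolutely continuous; with \<open>f\<close> a multiple
  of \<open>g\<close> it gives closure under scaling.
\<close>

lemma abs_continuous_on_dominated:
  fixes f :: "real \<Rightarrow> 'a::real_normed_vector" and g :: "real \<Rightarrow> 'b::real_normed_vector"
  assumes g: "abs_continuous_on a b g"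
    and le: "\<And>s t. \<lbrakk>s \<in> {a..b}; t \<in> {a..b}\<rbrakk> \<Longrightarrow> norm (f t - f s) \<le> C * norm (g t - g s)"
  shows "abs_continuous_on a b f"
  unfolding abs_continuous_on_def
proof (intro allI impI)
  fix \<epsilon> :: real assume "\<epsilon> > 0"
  \<comment> \<open>\<open>C\<close> may be zero or negative, but \<open>\<epsilon>\<close> has to be divided by the bound.\<close>
  define C' where "C' = max C 1"
  have C': "C' > 0" "\<And>r. 0 \<le> r \<Longrightarrow> C * r \<le> C' * r"
    unfolding C'_def by (auto intro: mult_right_mono)
  have e2: "\<epsilon> / C' > 0" using \<open>\<epsilon> > 0\<close> C' by simp
  obtain \<delta> where d: "\<delta> > 0" "\<forall>D S. D division_of S \<and> S \<subseteq> {a..b} \<and> (\<Sum>K\<in>D. Sup K - Inf K) < \<delta> \<longrightarrow>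
        (\<Sum>K\<in>D. norm (g (Sup K) - g (Inf K))) < \<epsilon> / C'"
    using g e2 unfolding abs_continuous_on_def by meson
  show "\<exists>\<delta>>0. \<forall>D S. D division_of S \<and> S \<subseteq> {a..b} \<and> (\<Sum>K\<in>D. Sup K - Inf K) < \<delta> \<longrightarrow>
        (\<Sum>K\<in>D. norm (f (Sup K) - f (Inf K))) < \<epsilon>"
  proof (intro exI[of _ \<delta>] conjI allI impI)
    fix D S assume D: "D division_of S \<and> S \<subseteq> {a..b} \<and> (\<Sum>K\<in>D. Sup K - Inf K) < \<delta>"
    have "(\<Sum>K\<in>D. norm (f (Sup K) - f (Inf K)))
        \<le> (\<Sum>K\<in>D. C' * norm (g (Sup K) - g (Inf K)))"
    proof (rule sum_mono)
      fix K assume "K \<in> D"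
      then obtain u v where K: "u \<le> v" "Sup K = v" "Inf K = u" "{u..v} \<subseteq> S"
        using D division_of_realE[of D S K] by metis
      then have "{u..v} \<subseteq> {a..b}" using D order_trans[OF K(4)] by blast
      then have "norm (f (Sup K) - f (Inf K)) \<le> C * norm (g (Sup K) - g (Inf K))"
        unfolding K using K(1) by (intro le) auto
      also have "\<dots> \<le> C' * norm (g (Sup K) - g (Inf K))" by (intro C') simp
      finally show "norm (f (Sup K) - f (Inf K)) \<le> C' * norm (g (Sup K) - g (Inf K))" .
    qed
    also have "\<dots> < \<epsilon>"
      using d(2)[rule_format, OF D] C' by (simp only: sum_distrib_left[symmetric] pos_less_divide_eq mult.commute)
    finally show "(\<Sum>K\<in>D. norm (f (Sup K) - f (Inf K))) < \<epsilon>" .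
  qed (use d(1) in simp)
qed

lemma abs_continuous_on_ident: "abs_continuous_on a b (\<lambda>t::real. t)"
proof -
  have "(\<Sum>K\<in>D. norm (Sup K - Inf K)) = (\<Sum>K\<in>D. Sup K - Inf K)" if D: "D division_of S" for D S
  proof (rule sum.cong)
    fix K assume "K \<in> D"
    then obtain u v where "u \<le> v" "Sup K = v" "Inf K = u"
      using division_of_realE[OF D] by metis
    then show "norm (Sup K - Inf K) = Sup K - Inf K" by simp
  qed simp
  then show ?thesis unfolding abs_continuous_on_def by metis
qed

lemma abs_continuous_on_imp_continuous_on:
  assumes "abs_continuous_on a b f"
  shows "continuous_on {a..b} f"
  unfolding continuous_on_iff
proof (intro ballI allI impI)
  fix s \<epsilon> :: real assume s: "s \<in> {a..b}" and "\<epsilon> > 0"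
  then obtain \<delta> where d: "\<delta> > 0" "\<forall>D S. D division_of S \<and> S \<subseteq> {a..b} \<and> (\<Sum>K\<in>D. Sup K - Inf K) < \<delta> \<longrightarrow>
        (\<Sum>K\<in>D. norm (f (Sup K) - f (Inf K))) < \<epsilon>"
    using assms unfolding abs_continuous_on_def by meson
  have "dist (f t) (f s) < \<epsilon>" if t: "t \<in> {a..b}" "dist t s < \<delta>" for t
  proof -
    have "{cbox (min s t) (max s t)} division_of cbox (min s t) (max s t)"
      by (intro division_of_self) auto
    then have "norm (f (max s t) - f (min s t)) < \<epsilon>"
      using d(2)[rule_format, of "{cbox (min s t) (max s t)}" "cbox (min s t) (max s t)"] s t
      by (auto simp: dist_real_def min_def max_def split: if_splits)
    then show ?thesis
      by (auto simp: dist_norm min_def max_def norm_minus_commute split: if_splits)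
  qed
  with d(1) show "\<exists>\<delta>>0. \<forall>t\<in>{a..b}. dist t s < \<delta> \<longrightarrow> dist (f t) (f s) < \<epsilon>" by blast
qed

text \<open>
  Absolute continuity speaks of divisions, whereas gauge integration produces tagged partial
  divisions. Both sums agree, since two tags can share an interval only if it is degenerate, and
  over such an interval \<open>f\<close> has no increment. The intervals do not overlap, so their total length is
  at most the measure of any set \<open>W\<close> containing them.
\<close>

lemma abs_continuous_on_tagged_sum:
  fixes f :: "real \<Rightarrow> 'a::real_normed_vector"
  assumes p: "p tagged_partial_division_of {a..b}"
    and W: "W \<in> lmeasurable" "measure lebesgue W < \<delta>" "\<And>t K. (t, K) \<in> p \<Longrightarrow> K \<subseteq> W"
    and d: "\<forall>D S. D division_of S \<and> S \<subseteq> {a..b} \<and> (\<Sum>K\<in>D. Sup K - Inf K) < \<delta> \<longrightarrow>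
        (\<Sum>K\<in>D. norm (f (Sup K) - f (Inf K))) < \<epsilon>"
  shows "(\<Sum>(t, K)\<in>p. norm (f (Sup K) - f (Inf K))) < \<epsilon>"
proof -
  define S where "S = \<Union>(snd ` p)"
  have ptag: "p tagged_division_of S"
    unfolding S_def by (rule tagged_partial_division_of_Union_self[OF p])
  then have div: "snd ` p division_of S" by (rule division_of_tagged_division)
  have S: "S \<subseteq> {a..b}" "S \<subseteq> W"
    using W(3) tagged_partial_division_ofD(3)[OF p] unfolding S_def by fastforce+
  have "(\<Sum>K\<in>snd ` p. Sup K - Inf K) = (\<Sum>K\<in>snd ` p. measure lebesgue K)"
  proof (rule sum.cong)
    fix K assume "K \<in> snd ` p"
    then obtain u v where "u \<le> v" "K = {u..v}" "Sup K = v" "Inf K = u"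
      using division_of_realE[OF div] by metis
    then show "Sup K - Inf K = measure lebesgue K" by simp
  qed simp
  also have "\<dots> = measure lebesgue S" by (rule content_division[OF div])
  also have "\<dots> \<le> measure lebesgue W"
    using S W(1) lmeasurable_division[OF div] by (intro measure_mono_fmeasurable) auto
  also have "\<dots> < \<delta>" by (rule W)
  finally have lt: "(\<Sum>K\<in>snd ` p. norm (f (Sup K) - f (Inf K))) < \<epsilon>"
    using d[rule_format, of "snd ` p" S] div S(1) by simp
  \<comment> \<open>The values \<open>Sup {}\<close> and \<open>Inf {}\<close> are arbitrary, so the increment over \<open>{}\<close> has to be set to zero.\<close>
  define h where "h K = (if K = {} then 0 else norm (f (Sup K) - f (Inf K)))" for K :: "real set"
  have "(\<Sum>(t, K)\<in>p. norm (f (Sup K) - f (Inf K))) = (\<Sum>(t, K)\<in>p. h K)"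
    using tagged_partial_division_ofD(2)[OF p] unfolding h_def by (intro sum.cong) fastforce+
  also have "\<dots> = sum h (snd ` p)"
  proof (rule sum.over_tagged_division_lemma[OF ptag])
    fix u v :: real assume "box u v = {}"
    then have "v < u \<or> u = v" by auto
    then show "h (cbox u v) = 0" by (auto simp: h_def)
  qed
  also have "\<dots> = (\<Sum>K\<in>snd ` p. norm (f (Sup K) - f (Inf K)))"
    using division_ofD(3)[OF div] by (intro sum.cong) (auto simp: h_def)
  finally show ?thesis using lt by simp
qed

text \<open>
  The gauge integral gives a direct proof. Around a tag outside \<open>N\<close> the gauge is chosen so fine that
  the increment of \<open>f\<close> is close to its linear approximation, as for everywhere differentiable
  functions. Around a tag in \<open>N\<close> the gauge is an open set \<open>W\<close> of small measure covering \<open>N\<close>: the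
  intervals with such tags have small total length, and absolute continuity makes the sum of the
  increments of \<open>f\<close> over them small.
\<close>

theorem abs_continuous_on_FTC:
  fixes f :: "real \<Rightarrow> 'a::banach"
  assumes "a \<le> b" and ac: "abs_continuous_on a b f" and N: "negligible N"
    and deriv: "\<And>t. t \<in> {a..b} - N \<Longrightarrow> (f has_vector_derivative f' t) (at t within {a..b})"
  shows "(f' has_integral f b - f a) {a..b}"
proof -
  define g where "g t = (if t \<in> N then 0 else f' t)" for t
  have "(g has_integral f b - f a) (cbox a b)"
    unfolding has_integral
  proof (intro allI impI)
    fix \<epsilon> :: real assume "\<epsilon> > 0"
    define e where "e = \<epsilon> / (2 * (b - a + 1))"
    have e: "e > 0" "e * (b - a) \<le> \<epsilon> / 2"
      using \<open>\<epsilon> > 0\<close> \<open>a \<le> b\<close> by (auto simp: e_def field_simps)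
    have "\<epsilon> / 2 > 0" using \<open>\<epsilon> > 0\<close> by simp
    then obtain \<delta> where d: "\<delta> > 0"
      "\<forall>D S. D division_of S \<and> S \<subseteq> {a..b} \<and> (\<Sum>K\<in>D. Sup K - Inf K) < \<delta> \<longrightarrow>
        (\<Sum>K\<in>D. norm (f (Sup K) - f (Inf K))) < \<epsilon> / 2"
      using ac unfolding abs_continuous_on_def by meson
    have N0: "N \<in> null_sets lebesgue" using N negligible_iff_null_sets by blast
    obtain W where W: "open W" "N \<subseteq> W" "W - N \<in> lmeasurable" "emeasure lebesgue (W - N) < ennreal \<delta>"
      using sets_lebesgue_outer_open[OF null_setsD2[OF N0] d(1)] by blast
    have "emeasure lebesgue W = emeasure lebesgue (W - N)"
      using W(1) N0 by (simp add: emeasure_Diff_null_set lborelD_Collect)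
    with W(4) have Om: "W \<in> lmeasurable" "measure lebesgue W < \<delta>"
      using W(1) d(1) by (auto simp: fmeasurable_def emeasure_eq_ennreal_measure measure_def
          intro: order.strict_trans ennreal_less_top intro!: enn2real_less_iff[THEN iffD2])
    have "\<forall>x. \<exists>d>0. x \<in> {a..b} - N \<longrightarrow>
         (\<forall>y\<in>{a..b}. norm (y-x) < d \<longrightarrow> norm (f y - f x - (y-x) *\<^sub>R f' x) \<le> e * norm (y-x))"
      using deriv[unfolded has_vector_derivative_def has_derivative_within_alt] e(1)
      by (metis zero_less_one)
    then obtain r where r: "\<And>x. 0 < r x" "\<And>x y. \<lbrakk>x \<in> {a..b} - N; y \<in> {a..b}; norm (y-x) < r x\<rbrakk>
                        \<Longrightarrow> norm (f y - f x - (y-x) *\<^sub>R f' x) \<le> e * norm (y-x)"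
      by metis
    show "\<exists>\<gamma>. gauge \<gamma> \<and> (\<forall>p. p tagged_division_of cbox a b \<and> \<gamma> fine p \<longrightarrow>
            norm ((\<Sum>(x, K)\<in>p. measure lborel K *\<^sub>R g x) - (f b - f a)) < \<epsilon>)"
    proof (intro exI[of _ "\<lambda>t. if t \<in> N then W else ball t (r t)"] conjI allI impI)
      show "gauge (\<lambda>t. if t \<in> N then W else ball t (r t))"
        unfolding gauge_def using W r(1) by auto
    next
      fix p assume p: "p tagged_division_of cbox a b \<and> (\<lambda>t. if t \<in> N then W else ball t (r t)) fine p"
      then have ptag: "p tagged_division_of cbox a b"
        and fine: "(\<lambda>t. if t \<in> N then W else ball t (r t)) fine p" by auto
      have ba: "b - a = (\<Sum>(x,K)\<in>p. Sup K - Inf K)" "f b - f a = (\<Sum>(x,K)\<in>p. f(Sup K) - f(Inf K))"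
        using additive_tagged_division_1[where f= "\<lambda>x. x"] additive_tagged_division_1[where f= f]
            \<open>a \<le> b\<close> ptag by auto
      define err where "err = (\<lambda>(x, K). measure lborel K *\<^sub>R g x - (f (Sup K) - f (Inf K)))"
      define p1 where "p1 = {(x, K) \<in> p. x \<in> N}"
      define p2 where "p2 = {(x, K) \<in> p. x \<notin> N}"
      have fin: "finite p" using ptag by auto
      have psplit: "p = p1 \<union> p2" "p1 \<inter> p2 = {}" "finite p1" "finite p2" "p2 \<subseteq> p" "p1 \<subseteq> p"
        using fin unfolding p1_def p2_def by (auto intro: finite_subset[OF _ fin])
      have interval: "\<exists>u v. K = {u..v} \<and> u \<le> v \<and> u \<le> x \<and> x \<le> v \<and> a \<le> u \<and> v \<le> b \<and> Sup K = v \<and> Inf K = u"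
        if xK: "(x, K) \<in> p" for x K
      proof -
        obtain u v where K: "K = cbox u v" "x \<in> K" "K \<subseteq> cbox a b"
          using tagged_division_ofD(2-4)[OF ptag xK] by metis
        then show ?thesis by (intro exI[of _ u] exI[of _ v]) auto
      qed
      have "(\<Sum>(x, K)\<in>p. measure lborel K *\<^sub>R g x) - (f b - f a) = sum err p"
        unfolding ba(2) err_def by (simp add: split_def sum_subtractf)
      also have "\<dots> = sum err p1 + sum err p2"
        using psplit by (metis sum.union_disjoint)
      finally have eq: "norm ((\<Sum>(x, K)\<in>p. measure lborel K *\<^sub>R g x) - (f b - f a)) \<le> norm (sum err p1) + norm (sum err p2)"
        by (simp add: norm_triangle_ineq)
      have "norm (sum err p1) \<le> (\<Sum>(x, K)\<in>p1. norm (f (Sup K) - f (Inf K)))"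
        by (rule sum_norm_le) (auto simp: err_def p1_def g_def norm_minus_commute)
      also have "\<dots> < \<epsilon> / 2"
      proof (rule abs_continuous_on_tagged_sum[OF _ Om _ d(2)])
        show "p1 tagged_partial_division_of {a..b}"
          using ptag psplit by (auto simp: tagged_division_of_def intro: tagged_partial_division_subset)
        show "K \<subseteq> W" if "(t, K) \<in> p1" for t K
          using fineD[OF fine, of t K] that by (auto simp: p1_def)
      qed
      finally have 1: "norm (sum err p1) < \<epsilon> / 2" .
      have "norm (sum err p2) \<le> (\<Sum>n\<in>p2. e * (case n of (x, K) \<Rightarrow> Sup K - Inf K))"
      proof (rule sum_norm_le, safe)
        fix x K assume xK: "(x, K) \<in> p2"
        then have xp: "(x, K) \<in> p" "x \<notin> N" by (auto simp: p2_def)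
        obtain u v where K: "K = {u..v}" "u \<le> v" "u \<le> x" "x \<le> v" "a \<le> u" "v \<le> b" "Sup K = v" "Inf K = u"
          using interval[OF xp(1)] by blast
        have ball: "K \<subseteq> ball x (r x)" using fineD[OF fine xp(1)] xp(2) by simp
        have "u \<in> K" "v \<in> K" using K by auto
        then have uv: "norm (u - x) < r x" "norm (v - x) < r x"
          using ball by (auto simp: dist_real_def)
        have "norm (err (x, K)) = norm ((f u - f x - (u - x) *\<^sub>R f' x) - (f v - f x - (v - x) *\<^sub>R f' x))"
          using K xp(2) by (auto simp: err_def g_def algebra_simps)
        also have "\<dots> \<le> norm (f u - f x - (u - x) *\<^sub>R f' x) + norm (f v - f x - (v - x) *\<^sub>R f' x)"
          by (rule norm_triangle_ineq4)
        also have "\<dots> \<le> e * norm (u - x) + e * norm (v - x)"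
          using K uv xp(2) by (intro add_mono r(2)) auto
        also have "\<dots> = e * (Sup K - Inf K)" using K by (auto simp: algebra_simps)
        finally show "norm (err (x, K)) \<le> e * (Sup K - Inf K)" .
      qed
      also have "\<dots> \<le> (\<Sum>n\<in>p. e * (case n of (x, K) \<Rightarrow> Sup K - Inf K))"
      proof (rule sum_mono2[OF fin psplit(5)])
        fix n assume "n \<in> p - p2"
        then show "0 \<le> e * (case n of (x, K) \<Rightarrow> Sup K - Inf K)"
          using interval e(1) by (cases n) fastforce
      qed
      also have "\<dots> = e * (b - a)" unfolding ba(1) by (simp add: sum_distrib_left)
      finally have 2: "norm (sum err p2) \<le> \<epsilon> / 2" using e(2) by simp
      show "norm ((\<Sum>(x, K)\<in>p. measure lborel K *\<^sub>R g x) - (f b - f a)) < \<epsilon>"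
        using eq 1 2 by simp
    qed
  qed
  then show ?thesis
    using has_integral_spike[OF N, of "cbox a b" f' g] by (auto simp: g_def)
qed

section \<open>Square-integrable functions and Sobolev functions\<close>

lemma L2_borel_measurable: "f \<in> L2 \<tau> \<Longrightarrow> f \<in> borel_measurable (lebesgue_on {0..\<tau>})"
  and L2_norm_square_integrable: "f \<in> L2 \<tau> \<Longrightarrow> integrable (lebesgue_on {0..\<tau>}) (\<lambda>t. (norm (f t))\<^sup>2)"
  by (auto simp: L2_def)

lemma AE_lebesgue_on_iff:
  "(AE t in lebesgue_on {a..b::real}. P t) \<longleftrightarrow> (\<exists>N. negligible N \<and> (\<forall>t\<in>{a..b} - N. P t))"
proof -
  have "(AE t in lebesgue_on {a..b}. P t) \<longleftrightarrow> (AE t in lebesgue. t \<in> {a..b} \<longrightarrow> P t)"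
    by (rule AE_restrict_space_iff) simp
  also have "\<dots> \<longleftrightarrow> (\<exists>N. negligible N \<and> (\<forall>t\<in>{a..b} - N. P t))"
    unfolding eventually_ae_filter_negligible by (rule arg_cong[where f = Ex]) (auto simp: fun_eq_iff)
  finally show ?thesis .
qed

lemma borel_measurable_lebesgue_on_AE:
  fixes f g :: "real \<Rightarrow> 'a::euclidean_space"
  assumes "f \<in> borel_measurable (lebesgue_on {a..b})" "AE t in lebesgue_on {a..b}. f t = g t"
  shows "g \<in> borel_measurable (lebesgue_on {a..b})"
proof -
  have f: "(\<lambda>t. indicator {a..b} t *\<^sub>R f t) \<in> borel_measurable lebesgue"
    using assms(1) by (subst (asm) borel_measurable_restrict_space_iff) auto
  have "AE t in lebesgue. t \<in> {a..b} \<longrightarrow> f t = g t"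
    using assms(2) by (subst (asm) AE_restrict_space_iff) auto
  then have "AE t in lebesgue. indicator {a..b} t *\<^sub>R f t = indicator {a..b} t *\<^sub>R g t"
    by eventually_elim (auto simp: indicator_def)
  from borel_measurable_AE[OF f this] show ?thesis
    by (subst borel_measurable_restrict_space_iff) auto
qed

lemma L2_AE_cong:
  fixes f g :: "real \<Rightarrow> 'a::euclidean_space"
  assumes "f \<in> L2 \<tau>" "AE t in lebesgue_on {0..\<tau>}. f t = g t"
  shows "g \<in> L2 \<tau>"
proof -
  have f: "f \<in> borel_measurable (lebesgue_on {0..\<tau>})" and
    i: "integrable (lebesgue_on {0..\<tau>}) (\<lambda>t. (norm (f t))\<^sup>2)"
    using assms(1) by (auto simp: L2_def)
  have g: "g \<in> borel_measurable (lebesgue_on {0..\<tau>})"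
    by (rule borel_measurable_lebesgue_on_AE[OF f assms(2)])
  have "AE t in lebesgue_on {0..\<tau>}. (norm (f t))\<^sup>2 = (norm (g t))\<^sup>2"
    using assms(2) by eventually_elim simp
  then have "integrable (lebesgue_on {0..\<tau>}) (\<lambda>t. (norm (g t))\<^sup>2)"
    using i f g by (subst integrable_cong_AE[symmetric]) auto
  with g show ?thesis by (simp add: L2_def)
qed

lemma L2_dominated:
  assumes g: "g \<in> borel_measurable (lebesgue_on {0..\<tau>})"
    and f: "integrable (lebesgue_on {0..\<tau>}) f" and le: "\<And>t. (norm (g t))\<^sup>2 \<le> f t"
  shows "g \<in> L2 \<tau>"
proof -
  have "integrable (lebesgue_on {0..\<tau>}) (\<lambda>t. (norm (g t))\<^sup>2)"
  proof (rule Bochner_Integration.integrable_bound[OF f])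
    show "AE t in lebesgue_on {0..\<tau>}. norm ((norm (g t))\<^sup>2) \<le> norm (f t)"
      using le by (intro AE_I2) (auto intro: order_trans[OF _ abs_ge_self])
  qed (use g in measurable)
  with g show ?thesis by (simp add: L2_def)
qed

lemma L2_add:
  assumes "f \<in> L2 \<tau>" "g \<in> L2 \<tau>"
  shows "(\<lambda>t. f t + g t) \<in> L2 \<tau>"
proof (rule L2_dominated)
  show "(\<lambda>t. f t + g t) \<in> borel_measurable (lebesgue_on {0..\<tau>})"
    using assms by (intro borel_measurable_add L2_borel_measurable)
  show "integrable (lebesgue_on {0..\<tau>}) (\<lambda>t. 2 * (norm (f t))\<^sup>2 + 2 * (norm (g t))\<^sup>2)"
    using assms by (intro Bochner_Integration.integrable_add integrable_mult_right L2_norm_square_integrable)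
  show "(norm (f t + g t))\<^sup>2 \<le> 2 * (norm (f t))\<^sup>2 + 2 * (norm (g t))\<^sup>2" for t
  proof -
    have "(norm (f t + g t))\<^sup>2 \<le> (norm (f t) + norm (g t))\<^sup>2"
      by (intro power_mono norm_triangle_ineq) simp
    also have "\<dots> \<le> 2 * (norm (f t))\<^sup>2 + 2 * (norm (g t))\<^sup>2"
      using sum_squares_bound[of "norm (f t)" "norm (g t)"] by (simp add: power2_sum)
    finally show ?thesis .
  qed
qed

lemma L2_linear:
  fixes h :: "'a::euclidean_space \<Rightarrow> 'b::euclidean_space"
  assumes "f \<in> L2 \<tau>" "linear h"
  shows "(\<lambda>t. h (f t)) \<in> L2 \<tau>"
proof -
  obtain K where K: "\<And>x. norm (h x) \<le> norm x * K"
    using assms(2) linear_conv_bounded_linear bounded_linear.bounded by blast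
  show ?thesis
  proof (rule L2_dominated)
    have "h \<in> borel_measurable borel"
      using assms(2) by (intro borel_measurable_continuous_onI linear_continuous_on) (simp add: linear_conv_bounded_linear)
    then show "(\<lambda>t. h (f t)) \<in> borel_measurable (lebesgue_on {0..\<tau>})"
      using L2_borel_measurable[OF assms(1)] by measurable
    show "integrable (lebesgue_on {0..\<tau>}) (\<lambda>t. K\<^sup>2 * (norm (f t))\<^sup>2)"
      using assms by (intro integrable_mult_right L2_norm_square_integrable)
    show "(norm (h (f t)))\<^sup>2 \<le> K\<^sup>2 * (norm (f t))\<^sup>2" for t
      using power_mono[OF K[of "f t"], of 2] by (simp add: power_mult_distrib mult.commute)
  qed
qed

lemma L2_integrable_scaleR:
  fixes f :: "real \<Rightarrow> real" and g :: "real \<Rightarrow> 'a::euclidean_space"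
  assumes "f \<in> L2 \<tau>" "g \<in> L2 \<tau>"
  shows "integrable (lebesgue_on {0..\<tau>}) (\<lambda>t. f t *\<^sub>R g t)"
proof (rule Bochner_Integration.integrable_bound)
  show "integrable (lebesgue_on {0..\<tau>}) (\<lambda>t. (norm (f t))\<^sup>2 + (norm (g t))\<^sup>2)"
    using assms by (intro Bochner_Integration.integrable_add L2_norm_square_integrable)
  show "(\<lambda>t. f t *\<^sub>R g t) \<in> borel_measurable (lebesgue_on {0..\<tau>})"
    using assms by (intro borel_measurable_scaleR L2_borel_measurable)
  show "AE t in lebesgue_on {0..\<tau>}. norm (f t *\<^sub>R g t) \<le> norm ((norm (f t))\<^sup>2 + (norm (g t))\<^sup>2)"
  proof (rule AE_I2)
    fix t
    have "norm (f t) * norm (g t) \<le> (norm (f t))\<^sup>2 + (norm (g t))\<^sup>2"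
      using sum_squares_bound[of "norm (f t)" "norm (g t)"]
        mult_nonneg_nonneg[OF norm_ge_zero[of "f t"] norm_ge_zero[of "g t"]] by linarith
    then show "norm (f t *\<^sub>R g t) \<le> norm ((norm (f t))\<^sup>2 + (norm (g t))\<^sup>2)" by simp
  qed
qed

lemma continuous_on_imp_L2:
  fixes f :: "real \<Rightarrow> 'a::euclidean_space"
  assumes "continuous_on {0..\<tau>} f"
  shows "f \<in> L2 \<tau>"
  unfolding L2_def using assms
  by (auto intro!: continuous_imp_measurable_on_sets_lebesgue continuous_imp_integrable_real continuous_intros)

lemma L2_imp_integrable:
  fixes f :: "real \<Rightarrow> 'a::euclidean_space"
  assumes "f \<in> L2 \<tau>"
  shows "integrable (lebesgue_on {0..\<tau>}) f"
proof -
  have "(\<lambda>t. 1) \<in> L2 \<tau>" by (intro continuous_on_imp_L2 continuous_intros)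
  from L2_integrable_scaleR[OF this assms] show ?thesis by simp
qed

lemma derivative_on_eqI:
  fixes f :: "real \<Rightarrow> 'a::euclidean_space"
  assumes "\<tau> > 0" "t \<in> {0..\<tau>}" "(f has_vector_derivative d) (at t within {0..\<tau>})"
  shows "derivative_on \<tau> f t = d"
  unfolding derivative_on_def using vector_derivative_within_closed_interval[OF assms] .

text \<open>
  The total function \<open>derivative_on \<tau> f\<close> has arbitrary values where \<open>f\<close> is not differentiable. The
  lemma transfers square-integrability to it from a function \<open>g\<close> that is known explicitly.
\<close>

lemma H1I:
  fixes f :: "real \<Rightarrow> 'a::euclidean_space"
  assumes "\<tau> > 0" "abs_continuous_on 0 \<tau> f" "g \<in> L2 \<tau>"
    and deriv: "AE t in lebesgue_on {0..\<tau>}. (f has_vector_derivative g t) (at t within {0..\<tau>})"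
  shows "f \<in> H1 \<tau>" "AE t in lebesgue_on {0..\<tau>}. derivative_on \<tau> f t = g t"
proof -
  show 1: "AE t in lebesgue_on {0..\<tau>}. derivative_on \<tau> f t = g t"
    using deriv by (rule lebesgue_on_mono) (rule derivative_on_eqI[OF \<open>\<tau> > 0\<close>])
  have "AE t in lebesgue_on {0..\<tau>}. g t = derivative_on \<tau> f t"
    using 1 by eventually_elim simp
  then have "derivative_on \<tau> f \<in> L2 \<tau>" by (rule L2_AE_cong[OF assms(3)])
  moreover have "AE t in lebesgue_on {0..\<tau>}. f differentiable (at t within {0..\<tau>})"
    using deriv by eventually_elim (rule differentiableI_vector)
  ultimately show "f \<in> H1 \<tau>" using assms(2) by (simp add: H1_def)
qed

lemma H1_abs_continuous_on: "f \<in> H1 \<tau> \<Longrightarrow> abs_continuous_on 0 \<tau> f"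
  and H1_derivative_L2: "f \<in> H1 \<tau> \<Longrightarrow> derivative_on \<tau> f \<in> L2 \<tau>"
  by (auto simp: H1_def)

lemma H1_has_derivative:
  assumes "f \<in> H1 \<tau>"
  shows "AE t in lebesgue_on {0..\<tau>}. (f has_vector_derivative derivative_on \<tau> f t) (at t within {0..\<tau>})"
proof -
  have "AE t in lebesgue_on {0..\<tau>}. f differentiable (at t within {0..\<tau>})"
    using assms by (simp add: H1_def)
  then show ?thesis
    by eventually_elim (simp add: derivative_on_def vector_derivative_works)
qed

lemma H1_imp_L2: "f \<in> H1 \<tau> \<Longrightarrow> f \<in> L2 \<tau>"
  by (intro continuous_on_imp_L2 abs_continuous_on_imp_continuous_on H1_abs_continuous_on)

lemma H1_FTC:
  fixes f :: "real \<Rightarrow> 'a::euclidean_space"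
  assumes f: "f \<in> H1 \<tau>" and t: "t \<in> {0..\<tau>}"
  shows "(derivative_on \<tau> f has_integral f t - f 0) {0..t}"
proof -
  obtain N where N: "negligible N"
    "\<And>s. s \<in> {0..\<tau>} - N \<Longrightarrow> (f has_vector_derivative derivative_on \<tau> f s) (at s within {0..\<tau>})"
    using H1_has_derivative[OF f] unfolding AE_lebesgue_on_iff by blast
  show ?thesis
  proof (rule abs_continuous_on_FTC[OF _ _ N(1)])
    show "abs_continuous_on 0 t f"
      using t by (intro abs_continuous_on_subset[OF H1_abs_continuous_on[OF f]]) auto
    show "(f has_vector_derivative derivative_on \<tau> f s) (at s within {0..t})" if "s \<in> {0..t} - N" for s
      using t that by (intro has_vector_derivative_within_subset[OF N(2)]) auto
  qed (use t in auto)
qed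

text \<open>
  Both sides are the integral of \<open>h t * g s\<close> over the triangle \<open>0 \<le> s \<le> t \<le> \<tau>\<close>. With \<open>h\<close> the
  derivative of a test function this becomes integration by parts.
\<close>

lemma integral_primitive_swap:
  fixes g h :: "real \<Rightarrow> real"
  assumes g: "integrable (lebesgue_on {0..\<tau>}) g" and h: "integrable (lebesgue_on {0..\<tau>}) h"
  shows "(LINT t|lebesgue_on {0..\<tau>}. h t * integral {0..t} g)
       = (LINT s|lebesgue_on {0..\<tau>}. g s * integral {s..\<tau>} h)"
proof -
  define M where "M = lebesgue_on {0..\<tau>}"
  have space: "space M = {0..\<tau>}" by (simp add: M_def)
  interpret finite_measure M unfolding M_def by (rule finite_measure_lebesgue_on) simp
  interpret pair_sigma_finite M M ..
  have gM: "integrable M g" and hM: "integrable M h" using g h by (simp_all add: M_def)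
  have [measurable]: "g \<in> borel_measurable M" "h \<in> borel_measurable M" using gM hM by auto
  have [measurable]: "(\<lambda>t. t) \<in> borel_measurable M"
    unfolding M_def by (intro continuous_imp_measurable_on_sets_lebesgue continuous_intros) simp
  define k where "k t s = h t * (if s \<le> t then g s else 0)" for t s
  have prod: "integrable (M \<Otimes>\<^sub>M M) (\<lambda>p. h (fst p) * g (snd p))"
    by (rule Fubini_integrable) (use gM hM in \<open>auto simp: abs_mult\<close>)
  have "integrable (M \<Otimes>\<^sub>M M) (case_prod k)"
  proof (rule Bochner_Integration.integrable_bound[OF prod])
    show "case_prod k \<in> borel_measurable (M \<Otimes>\<^sub>M M)"
      unfolding k_def by measurable
    show "AE p in M \<Otimes>\<^sub>M M. norm (case_prod k p) \<le> norm (h (fst p) * g (snd p))"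
      by (rule AE_I2) (auto simp: k_def)
  qed
  then have "(LINT s|M. (LINT t|M. k t s)) = (LINT t|M. (LINT s|M. k t s))"
    by (rule Fubini_integral)
  moreover have "(LINT s|M. k t s) = h t * integral {0..t} g" if "t \<in> space M" for t
  proof -
    have t: "{..t} \<inter> {0..\<tau>} = {0..t}" using that by (auto simp: space)
    have "(LINT s|M. (if s \<in> {..t} then g s else 0)) = integral\<^sup>L (lebesgue_on ({..t} \<inter> {0..\<tau>})) g"
      unfolding M_def by (rule Lebesgue_Measure.integral_restrict_Int) auto
    also have "\<dots> = integral {0..t} g"
    proof -
      have "integrable (lebesgue_on {0..t}) g"
        using g that by (rule_tac integrable_subinterval[of 0 \<tau>]) (auto simp: space)
      then show ?thesis unfolding t by (rule lebesgue_integral_eq_integral) auto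
    qed
    finally show ?thesis by (simp add: k_def)
  qed
  moreover have "(LINT t|M. k t s) = g s * integral {s..\<tau>} h" if "s \<in> space M" for s
  proof -
    have s: "{s..} \<inter> {0..\<tau>} = {s..\<tau>}" using that by (auto simp: space)
    have "(LINT t|M. (if t \<in> {s..} then h t else 0)) = integral\<^sup>L (lebesgue_on ({s..} \<inter> {0..\<tau>})) h"
      unfolding M_def by (rule Lebesgue_Measure.integral_restrict_Int) auto
    also have "\<dots> = integral {s..\<tau>} h"
    proof -
      have "integrable (lebesgue_on {s..\<tau>}) h"
        using h that by (rule_tac integrable_subinterval[of 0 \<tau>]) (auto simp: space)
      then show ?thesis unfolding s by (rule lebesgue_integral_eq_integral) auto
    qed
    finally have eq: "(LINT t|M. (if t \<in> {s..} then h t else 0)) = integral {s..\<tau>} h" .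
    have "(LINT t|M. k t s) = (LINT t|M. g s * (if t \<in> {s..} then h t else 0))"
      by (intro Bochner_Integration.integral_cong) (auto simp: k_def)
    then show ?thesis using eq by simp
  qed
  ultimately show ?thesis unfolding M_def[symmetric]
    by (simp cong: Bochner_Integration.integral_cong)
qed

section \<open>The Hilbert space of test functions\<close>

lemma H1_add_scaleR:
  fixes f g :: "real \<Rightarrow> 'a::euclidean_space"
  assumes "\<tau> > 0" "f \<in> H1 \<tau>" "g \<in> H1 \<tau>"
  shows "(\<lambda>t. f t + c *\<^sub>R g t) \<in> H1 \<tau>"
    and "AE t in lebesgue_on {0..\<tau>}. derivative_on \<tau> (\<lambda>t. f t + c *\<^sub>R g t) t
           = derivative_on \<tau> f t + c *\<^sub>R derivative_on \<tau> g t"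
proof -
  have cg: "abs_continuous_on 0 \<tau> (\<lambda>t. c *\<^sub>R g t)"
    by (rule abs_continuous_on_dominated[OF H1_abs_continuous_on[OF assms(3)], of _ "\<bar>c\<bar>"])
      (simp add: scaleR_diff_right[symmetric])
  have ac: "abs_continuous_on 0 \<tau> (\<lambda>t. f t + c *\<^sub>R g t)"
    by (rule abs_continuous_on_add[OF H1_abs_continuous_on[OF assms(2)] cg])
  have L2: "(\<lambda>t. derivative_on \<tau> f t + c *\<^sub>R derivative_on \<tau> g t) \<in> L2 \<tau>"
    using assms by (intro L2_add L2_linear[where h = "\<lambda>y. c *\<^sub>R y"] H1_derivative_L2) (auto simp: linear_iff algebra_simps)
  have "AE t in lebesgue_on {0..\<tau>}. ((\<lambda>t. f t + c *\<^sub>R g t) has_vector_derivative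
          derivative_on \<tau> f t + c *\<^sub>R derivative_on \<tau> g t) (at t within {0..\<tau>})"
    using H1_has_derivative[OF assms(2)] H1_has_derivative[OF assms(3)]
    by eventually_elim (auto intro!: derivative_eq_intros)
  from H1I[OF assms(1) ac L2 this]
  show "(\<lambda>t. f t + c *\<^sub>R g t) \<in> H1 \<tau>"
    and "AE t in lebesgue_on {0..\<tau>}. derivative_on \<tau> (\<lambda>t. f t + c *\<^sub>R g t) t
           = derivative_on \<tau> f t + c *\<^sub>R derivative_on \<tau> g t" by auto
qed

lemma H10_imp_H1: "\<phi> \<in> H10 \<tau> \<Longrightarrow> \<phi> \<in> H1 \<tau>"
  by (simp add: H10_def)

lemma H10_add_scale:
  assumes "\<tau> > 0" "\<phi> \<in> H10 \<tau>" "\<psi> \<in> H10 \<tau>"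
  shows "(\<lambda>t. \<phi> t + c * \<psi> t) \<in> H10 \<tau>"
  using assms H1_add_scaleR(1)[OF assms(1), of \<phi> \<psi> c] by (auto simp: H10_def)

lemma H10_integral_derivative:
  assumes "\<phi> \<in> H10 \<tau>" "s \<in> {0..\<tau>}"
  shows "integral {s..\<tau>} (derivative_on \<tau> \<phi>) = - \<phi> s"
proof -
  have \<phi>: "\<phi> \<in> H1 \<tau>" "\<phi> 0 = 0" "\<phi> \<tau> = 0" using assms(1) by (auto simp: H10_def)
  have s: "(derivative_on \<tau> \<phi> has_integral \<phi> s) {0..s}"
    and \<tau>: "(derivative_on \<tau> \<phi> has_integral 0) {0..\<tau>}"
    using H1_FTC[OF \<phi>(1), of s] H1_FTC[OF \<phi>(1), of \<tau>] \<phi> assms(2) by auto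
  have "integral {0..s} (derivative_on \<tau> \<phi>) + integral {s..\<tau>} (derivative_on \<tau> \<phi>)
      = integral {0..\<tau>} (derivative_on \<tau> \<phi>)"
    using assms(2) \<tau> by (intro Henstock_Kurzweil_Integration.integral_combine) auto
  then show ?thesis using s \<tau> by (simp add: integral_unique)
qed

lemma H10_lebesgue_integral_derivative:
  assumes "\<phi> \<in> H10 \<tau>"
  shows "(LINT t|lebesgue_on {0..\<tau>}. derivative_on \<tau> \<phi> t) = 0"
proof (cases "0 \<le> \<tau>")
  case True
  have "(LINT t|lebesgue_on {0..\<tau>}. derivative_on \<tau> \<phi> t) = integral {0..\<tau>} (derivative_on \<tau> \<phi>)"
    by (intro lebesgue_integral_eq_integral L2_imp_integrable H1_derivative_L2 H10_imp_H1 assms) simp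
  then show ?thesis
    using H10_integral_derivative[OF assms, of 0] True assms by (simp add: H10_def)
qed simp

lemma integral_derivative_times_primitive:
  assumes \<phi>: "\<phi> \<in> H10 \<tau>" and g: "integrable (lebesgue_on {0..\<tau>}) g"
  shows "(LINT t|lebesgue_on {0..\<tau>}. derivative_on \<tau> \<phi> t * integral {0..t} g)
       = - (LINT t|lebesgue_on {0..\<tau>}. \<phi> t * g t)"
proof -
  have "integrable (lebesgue_on {0..\<tau>}) (derivative_on \<tau> \<phi>)"
    by (intro L2_imp_integrable H1_derivative_L2 H10_imp_H1 \<phi>)
  note integral_primitive_swap[OF g this]
  also have "(LINT s|lebesgue_on {0..\<tau>}. g s * integral {s..\<tau>} (derivative_on \<tau> \<phi>))
      = (LINT s|lebesgue_on {0..\<tau>}. - (\<phi> s * g s))"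
    by (intro Bochner_Integration.integral_cong) (auto simp: H10_integral_derivative[OF \<phi>])
  finally show ?thesis by simp
qed

lemma H10_inner_add_scale:
  assumes "\<tau> > 0" "\<phi> \<in> H10 \<tau>" "\<psi> \<in> H10 \<tau>" "\<eta> \<in> H10 \<tau>"
  shows "H10_inner \<tau> \<phi> (\<lambda>t. \<psi> t + c * \<eta> t) = H10_inner \<tau> \<phi> \<psi> + c * H10_inner \<tau> \<phi> \<eta>"
proof -
  note d = H1_derivative_L2[OF H10_imp_H1]
  have int: "integrable (lebesgue_on {0..\<tau>}) (\<lambda>t. derivative_on \<tau> \<phi> t * derivative_on \<tau> \<psi> t)"
    "integrable (lebesgue_on {0..\<tau>}) (\<lambda>t. derivative_on \<tau> \<phi> t * derivative_on \<tau> \<eta> t)"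
    using L2_integrable_scaleR[OF d d, OF assms(2,3)] L2_integrable_scaleR[OF d d, OF assms(2,4)] by auto
  have sum: "(\<lambda>t. \<psi> t + c * \<eta> t) \<in> H10 \<tau>" using assms by (intro H10_add_scale)
  note [measurable] = L2_borel_measurable[OF d[OF assms(2)]] L2_borel_measurable[OF d[OF assms(3)]]
    L2_borel_measurable[OF d[OF assms(4)]] L2_borel_measurable[OF d[OF sum]]
  have ae: "AE t in lebesgue_on {0..\<tau>}. derivative_on \<tau> (\<lambda>t. \<psi> t + c * \<eta> t) t
           = derivative_on \<tau> \<psi> t + c * derivative_on \<tau> \<eta> t"
    using H1_add_scaleR(2)[OF assms(1) H10_imp_H1[OF assms(3)] H10_imp_H1[OF assms(4)], of c] by simp
  have "H10_inner \<tau> \<phi> (\<lambda>t. \<psi> t + c * \<eta> t)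
      = (LINT t|lebesgue_on {0..\<tau>}. derivative_on \<tau> \<phi> t * derivative_on \<tau> \<psi> t
          + c * (derivative_on \<tau> \<phi> t * derivative_on \<tau> \<eta> t))"
    unfolding H10_inner_def
  proof (rule integral_cong_AE)
    show "AE t in lebesgue_on {0..\<tau>}. derivative_on \<tau> \<phi> t * derivative_on \<tau> (\<lambda>t. \<psi> t + c * \<eta> t) t
        = derivative_on \<tau> \<phi> t * derivative_on \<tau> \<psi> t + c * (derivative_on \<tau> \<phi> t * derivative_on \<tau> \<eta> t)"
      using ae by eventually_elim (simp add: algebra_simps)
  qed measurable
  also have "\<dots> = H10_inner \<tau> \<phi> \<psi> + c * H10_inner \<tau> \<phi> \<eta>"
    unfolding H10_inner_def using int by simp
  finally show ?thesis .
qed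

text \<open>
  The derivative vanishes almost everywhere, and \<open>\<phi>\<close> is its integral. Outside \<open>{0..\<tau>}\<close>, functions in
  \<open>H10 \<tau>\<close> are zero by definition.
\<close>

lemma H10_inner_eq_0_imp:
  assumes "\<phi> \<in> H10 \<tau>" "H10_inner \<tau> \<phi> \<phi> = 0"
  shows "\<phi> = (\<lambda>t. 0)"
proof -
  note d = H1_derivative_L2[OF H10_imp_H1[OF assms(1)]]
  have "integrable (lebesgue_on {0..\<tau>}) (\<lambda>t. derivative_on \<tau> \<phi> t * derivative_on \<tau> \<phi> t)"
    using L2_integrable_scaleR[OF d d] by simp
  then have "AE t in lebesgue_on {0..\<tau>}. derivative_on \<tau> \<phi> t * derivative_on \<tau> \<phi> t = 0"
    using assms(2) unfolding H10_inner_def by (subst (asm) integral_nonneg_eq_0_iff_AE) auto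
  then have "AE t in lebesgue_on {0..\<tau>}. derivative_on \<tau> \<phi> t = 0"
    by eventually_elim simp
  then obtain N where N: "negligible N" "\<And>t. t \<in> {0..\<tau>} - N \<Longrightarrow> derivative_on \<tau> \<phi> t = 0"
    unfolding AE_lebesgue_on_iff by blast
  show "\<phi> = (\<lambda>t. 0)"
  proof
    fix t
    show "\<phi> t = 0"
    proof (cases "t \<in> {0..\<tau>}")
      case True
      have "(derivative_on \<tau> \<phi> has_integral \<phi> t) {0..t}"
        using H1_FTC[OF H10_imp_H1[OF assms(1)] True] assms(1) by (simp add: H10_def)
      moreover have "(derivative_on \<tau> \<phi> has_integral 0) {0..t}"
        using True N by (intro has_integral_spike[OF N(1) _ has_integral_0]) auto
      ultimately show ?thesis by (rule has_integral_unique)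
    qed (use assms(1) in \<open>auto simp: H10_def\<close>)
  qed
qed

lemma H10_eqI:
  assumes "\<tau> > 0" "\<phi> \<in> H10 \<tau>" "\<psi> \<in> H10 \<tau>"
    and eq: "\<And>\<eta>. \<eta> \<in> H10 \<tau> \<Longrightarrow> H10_inner \<tau> \<eta> \<phi> = H10_inner \<tau> \<eta> \<psi>"
  shows "\<phi> = \<psi>"
proof -
  define \<delta> where "\<delta> = (\<lambda>t. \<phi> t + (-1) * \<psi> t)"
  have \<delta>: "\<delta> \<in> H10 \<tau>" unfolding \<delta>_def by (rule H10_add_scale[OF assms(1-3)])
  have "H10_inner \<tau> \<delta> \<delta> = H10_inner \<tau> \<delta> \<phi> + (-1) * H10_inner \<tau> \<delta> \<psi>"
    unfolding \<delta>_def by (rule H10_inner_add_scale[OF assms(1) \<delta>[unfolded \<delta>_def] assms(2,3)])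
  then have "H10_inner \<tau> \<delta> \<delta> = 0" using eq[OF \<delta>] by simp
  then have "\<delta> = (\<lambda>t. 0)" by (rule H10_inner_eq_0_imp[OF \<delta>])
  then have "\<delta> t = 0" for t by simp
  then show ?thesis by (auto simp: \<delta>_def fun_eq_iff)
qed

section \<open>The boundary value problem and the fundamental lemma\<close>

text \<open>
  The solution of \<open>- \<psi>'' = g\<close> with \<open>\<psi> 0 = \<psi> \<tau> = 0\<close>: minus the second primitive of \<open>g\<close>, plus the linear
  function that restores the boundary value at \<open>\<tau>\<close>. It is zero outside \<open>{0..\<tau>}\<close> because functions in
  \<open>H10 \<tau>\<close> are.
\<close>

definition dirichlet_solution :: "real \<Rightarrow> (real \<Rightarrow> real) \<Rightarrow> real \<Rightarrow> real" where
  "dirichlet_solution \<tau> g t = (if t \<in> {0..\<tau>}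
     then t / \<tau> * integral {0..\<tau>} (\<lambda>s. integral {0..s} g) - integral {0..t} (\<lambda>s. integral {0..s} g)
     else 0)"

text \<open>
  The first primitive of an integrable function is continuous, so the solution is continuously
  differentiable, hence Lipschitz.
\<close>

lemma dirichlet_solution:
  assumes "\<tau> > 0" and g: "integrable (lebesgue_on {0..\<tau>}) g"
  defines "c \<equiv> integral {0..\<tau>} (\<lambda>s. integral {0..s} g) / \<tau>"
  shows "dirichlet_solution \<tau> g \<in> H10 \<tau>"
    and "\<And>t. t \<in> {0..\<tau>} \<Longrightarrow> derivative_on \<tau> (dirichlet_solution \<tau> g) t = c - integral {0..t} g"
proof -
  define G where "G = (\<lambda>t. integral {0..t} g)"
  have G: "continuous_on {0..\<tau>} G"
    unfolding G_def by (intro indefinite_integral_continuous_1 integrable_on_lebesgue_on g) simp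
  have deriv: "(dirichlet_solution \<tau> g has_vector_derivative c - G t) (at t within {0..\<tau>})" if "t \<in> {0..\<tau>}" for t
  proof -
    have "((\<lambda>t. c * t - integral {0..t} G) has_vector_derivative c - G t) (at t within {0..\<tau>})"
      by (auto intro!: derivative_eq_intros integral_has_vector_derivative[OF G that])
    then show ?thesis
      using that by (rule_tac has_vector_derivative_transform) (auto simp: dirichlet_solution_def c_def G_def)
  qed
  have L2: "(\<lambda>t. c - G t) \<in> L2 \<tau>" by (intro continuous_on_imp_L2 continuous_intros G)
  have "compact ((\<lambda>t. c - G t) ` {0..\<tau>})"
    by (intro compact_continuous_image continuous_intros G) simp
  then obtain B where B: "\<And>t. t \<in> {0..\<tau>} \<Longrightarrow> norm (c - G t) \<le> B"
    by (meson bounded_iff compact_imp_bounded imageI)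
  have ac: "abs_continuous_on 0 \<tau> (dirichlet_solution \<tau> g)"
  proof (rule abs_continuous_on_dominated[OF abs_continuous_on_ident])
    show "norm (dirichlet_solution \<tau> g t - dirichlet_solution \<tau> g s) \<le> B * norm (t - s)"
      if "s \<in> {0..\<tau>}" "t \<in> {0..\<tau>}" for s t
      using that deriv B
      by (intro field_differentiable_bound[of "{0..\<tau>}" _ "\<lambda>t. c - G t"])
         (auto simp: has_real_derivative_iff_has_vector_derivative)
  qed
  have "dirichlet_solution \<tau> g \<in> H1 \<tau>"
    by (rule H1I(1)[OF assms(1) ac L2]) (use deriv in \<open>auto intro: AE_I2\<close>)
  then show "dirichlet_solution \<tau> g \<in> H10 \<tau>"
    using assms(1) by (auto simp: H10_def dirichlet_solution_def)
  show "derivative_on \<tau> (dirichlet_solution \<tau> g) t = c - integral {0..t} g" if "t \<in> {0..\<tau>}" for t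
    using derivative_on_eqI[OF assms(1) that deriv[OF that]] by (simp add: G_def)
qed

text \<open>
  This is the weak form of \<open>- \<psi>'' = g\<close>. With \<open>\<psi>' = c - G\<close>, where \<open>G\<close> is the primitive of \<open>g\<close>, the
  constant contributes nothing since \<open>\<integral> \<phi>' = 0\<close>, and \<open>- \<integral> \<phi>' G = \<integral> \<phi> g\<close>.
\<close>

lemma H10_inner_dirichlet_solution:
  assumes "\<tau> > 0" and g: "integrable (lebesgue_on {0..\<tau>}) g" and \<phi>: "\<phi> \<in> H10 \<tau>"
  shows "H10_inner \<tau> \<phi> (dirichlet_solution \<tau> g) = (LINT t|lebesgue_on {0..\<tau>}. \<phi> t * g t)"
proof -
  define c where "c = integral {0..\<tau>} (\<lambda>s. integral {0..s} g) / \<tau>"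
  have d: "derivative_on \<tau> \<phi> \<in> L2 \<tau>" by (intro H1_derivative_L2 H10_imp_H1 \<phi>)
  have G: "(\<lambda>t. integral {0..t} g) \<in> L2 \<tau>"
    by (intro continuous_on_imp_L2 indefinite_integral_continuous_1 integrable_on_lebesgue_on g) simp
  have "H10_inner \<tau> \<phi> (dirichlet_solution \<tau> g)
      = (LINT t|lebesgue_on {0..\<tau>}. c * derivative_on \<tau> \<phi> t - derivative_on \<tau> \<phi> t * integral {0..t} g)"
    unfolding H10_inner_def c_def
    by (intro Bochner_Integration.integral_cong) (auto simp: dirichlet_solution(2)[OF assms(1,2)] algebra_simps)
  also have "\<dots> = c * (LINT t|lebesgue_on {0..\<tau>}. derivative_on \<tau> \<phi> t)
      - (LINT t|lebesgue_on {0..\<tau>}. derivative_on \<tau> \<phi> t * integral {0..t} g)"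
    using L2_imp_integrable[OF d] L2_integrable_scaleR[OF d G] by simp
  also have "(LINT t|lebesgue_on {0..\<tau>}. derivative_on \<tau> \<phi> t) = 0"
    by (rule H10_lebesgue_integral_derivative[OF \<phi>])
  also have "(LINT t|lebesgue_on {0..\<tau>}. derivative_on \<tau> \<phi> t * integral {0..t} g)
      = - (LINT t|lebesgue_on {0..\<tau>}. \<phi> t * g t)"
    by (rule integral_derivative_times_primitive[OF \<phi> g])
  finally show ?thesis by simp
qed

text \<open>
  By Lebesgue differentiation, \<open>g t\<close> is for almost every \<open>t\<close> the limit of the averages of \<open>g\<close> over
  \<open>{t..t + k}\<close>, and all of these are zero.
\<close>

lemma AE_eq_0_if_integrals_eq_0:
  fixes g :: "real \<Rightarrow> 'a::euclidean_space"
  assumes g: "g integrable_on {a..b}"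
    and zero: "\<And>t. t \<in> {a..b} \<Longrightarrow> integral {a..t} g = 0"
  shows "AE t in lebesgue_on {a..b}. g t = 0"
proof -
  \<comment> \<open>Lebesgue differentiation is about functions that are integrable over every interval.\<close>
  define h where "h t = (if t \<in> {a..b} then g t else 0)" for t
  have "h integrable_on UNIV" using g integrable_restrict_UNIV[of "{a..b}" g] by (simp add: h_def[abs_def])
  then have int: "\<And>c d. h integrable_on cbox c d" by (rule integrable_on_subcbox) simp
  obtain N where N: "negligible N" "\<And>x e. \<lbrakk>x \<notin> N; 0 < e\<rbrakk> \<Longrightarrow>
      \<exists>d>0. \<forall>k. 0 < k \<and> k < d \<longrightarrow>
        norm (integral (cbox x (x + k *\<^sub>R One)) h /\<^sub>R k ^ DIM(real) - h x) < e"
    using integrable_ccontinuous_explicit[OF int] by metis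
  \<comment> \<open>At \<open>b\<close> there is no room to the right inside \<open>{a..b}\<close>.\<close>
  have "g t = 0" if t: "t \<in> {a..b} - (N \<union> {b})" for t
  proof (rule ccontr)
    assume "g t \<noteq> 0"
    then have "norm (g t) > 0" by simp
    then obtain d where d: "d > 0" "\<And>k. 0 < k \<and> k < d \<Longrightarrow> norm (integral {t..t + k} h /\<^sub>R k - g t) < norm (g t)"
      using N(2)[of t "norm (g t)"] t by (auto simp: h_def)
    define k where "k = min (d / 2) (b - t)"
    have k: "0 < k" "k < d" "t + k \<le> b" using d(1) t by (auto simp: k_def)
    have "integral {t..t + k} h = integral {t..t + k} g"
      using t k by (intro integral_cong) (auto simp: h_def)
    moreover have "integral {a..t} g + integral {t..t + k} g = integral {a..t + k} g"
      using t k by (intro Henstock_Kurzweil_Integration.integral_combine integrable_subinterval_real[OF g]) auto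
    ultimately have "integral {t..t + k} h = 0" using zero[of t] zero[of "t + k"] t k by auto
    then show False using d(2)[of k] k by simp
  qed
  moreover have "negligible (N \<union> {b})" using N(1) by simp
  ultimately show ?thesis unfolding AE_lebesgue_on_iff by blast
qed

text \<open>
  The solution \<open>\<psi>\<close> for \<open>g\<close> is itself a test function. Testing with it gives \<open>\<integral> \<psi>' \<psi>' = 0\<close>, so \<open>\<psi> = 0\<close> and
  the primitive of \<open>g\<close>, which differs from \<open>- \<psi>'\<close> by a constant, is constant.
\<close>

lemma fundamental_lemma_H10:
  assumes "\<tau> > 0" and g: "integrable (lebesgue_on {0..\<tau>}) g"
    and zero: "\<And>\<phi>. \<phi> \<in> H10 \<tau> \<Longrightarrow> (LINT t|lebesgue_on {0..\<tau>}. \<phi> t * g t) = 0"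
  shows "AE t in lebesgue_on {0..\<tau>}. g t = 0"
proof -
  define c where "c = integral {0..\<tau>} (\<lambda>s. integral {0..s} g) / \<tau>"
  let ?\<psi> = "dirichlet_solution \<tau> g"
  note \<psi> = dirichlet_solution[OF assms(1,2)]
  have "H10_inner \<tau> ?\<psi> ?\<psi> = 0"
    using H10_inner_dirichlet_solution[OF assms(1,2) \<psi>(1)] zero[OF \<psi>(1)] by simp
  from H10_inner_eq_0_imp[OF \<psi>(1) this] have "?\<psi> = (\<lambda>t. 0)" .
  then have d0: "derivative_on \<tau> ?\<psi> t = 0" if "t \<in> {0..\<tau>}" for t
    using derivative_on_eqI[OF assms(1) that, of ?\<psi> 0] by simp
  have G: "integral {0..t} g = c" if "t \<in> {0..\<tau>}" for t
    using d0[OF that] \<psi>(2)[OF that] by (simp add: c_def)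
  have "c = 0" using G[of 0] assms(1) by simp
  with G show ?thesis
    using g by (intro AE_eq_0_if_integrals_eq_0 integrable_on_lebesgue_on) auto
qed

section \<open>Synthesis operators and their adjoints\<close>

lemma H10_imp_L2: "\<phi> \<in> H10 \<tau> \<Longrightarrow> \<phi> \<in> L2 \<tau>"
  by (intro H1_imp_L2 H10_imp_H1)

lemma L2_inner: "f \<in> L2 \<tau> \<Longrightarrow> (\<lambda>t. f t \<bullet> v) \<in> L2 \<tau>"
  by (intro L2_linear[where h = "\<lambda>y. y \<bullet> v"]) (auto simp: linear_iff inner_add_left)

lemma synthesis_linear:
  fixes h :: "real ^ 'k \<Rightarrow> real ^ 'l"
  assumes "linear h" "f \<in> L2 \<tau>" "\<phi> \<in> H10 \<tau>"
  shows "synthesis \<tau> (\<lambda>t. h (f t)) \<phi> = h (synthesis \<tau> f \<phi>)"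
proof -
  have "h (synthesis \<tau> f \<phi>) = (LINT t|lebesgue_on {0..\<tau>}. h (\<phi> t *\<^sub>R f t))"
    unfolding synthesis_def using assms
    by (intro integral_bounded_linear[symmetric] L2_integrable_scaleR H10_imp_L2) (simp_all add: linear_conv_bounded_linear)
  then show ?thesis by (simp add: synthesis_def linear_cmul[OF assms(1)])
qed

lemma synthesis_inner:
  assumes "f \<in> L2 \<tau>" "\<phi> \<in> H10 \<tau>"
  shows "synthesis \<tau> f \<phi> \<bullet> v = (LINT t|lebesgue_on {0..\<tau>}. \<phi> t * (f t \<bullet> v))"
  unfolding synthesis_def
  using integral_inner_left[OF L2_integrable_scaleR[OF H10_imp_L2[OF assms(2)] assms(1)], of v] by simp

lemma synthesis_add_scale:
  assumes "f \<in> L2 \<tau>" "\<phi> \<in> H10 \<tau>" "\<psi> \<in> H10 \<tau>"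
  shows "synthesis \<tau> f (\<lambda>t. \<phi> t + c * \<psi> t) = synthesis \<tau> f \<phi> + c *\<^sub>R synthesis \<tau> f \<psi>"
proof -
  have "integrable (lebesgue_on {0..\<tau>}) (\<lambda>t. \<phi> t *\<^sub>R f t)" "integrable (lebesgue_on {0..\<tau>}) (\<lambda>t. \<psi> t *\<^sub>R f t)"
    using assms by (auto intro: L2_integrable_scaleR H10_imp_L2)
  then have "(LINT t|lebesgue_on {0..\<tau>}. \<phi> t *\<^sub>R f t + c *\<^sub>R (\<psi> t *\<^sub>R f t))
      = synthesis \<tau> f \<phi> + c *\<^sub>R synthesis \<tau> f \<psi>"
    unfolding synthesis_def by (simp del: scaleR_scaleR)
  then show ?thesis by (simp add: synthesis_def scaleR_add_left)
qed

text \<open>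
  Integration by parts without boundary terms, since \<open>\<phi>\<close> vanishes at both ends. Componentwise \<open>x\<close> is
  its initial value plus the primitive of its derivative, and the initial value is integrated
  against \<open>\<phi>'\<close>, whose integral is zero.
\<close>

lemma synthesis_d_eq_synthesis_derivative:
  assumes x: "x \<in> H1 \<tau>" and \<phi>: "\<phi> \<in> H10 \<tau>"
  shows "synthesis_d \<tau> x \<phi> = synthesis \<tau> (derivative_on \<tau> x) \<phi>"
proof (rule vector_eq_rdot[THEN iffD1], rule allI)
  fix v
  define g where "g = (\<lambda>t. derivative_on \<tau> x t \<bullet> v)"
  have d: "derivative_on \<tau> \<phi> \<in> L2 \<tau>" by (intro H1_derivative_L2 H10_imp_H1 \<phi>)
  have dx: "derivative_on \<tau> x \<in> L2 \<tau>" by (rule H1_derivative_L2[OF x])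
  have g: "g \<in> L2 \<tau>" unfolding g_def by (rule L2_inner[OF dx])
  have xg: "x t \<bullet> v = x 0 \<bullet> v + integral {0..t} g" if "t \<in> {0..\<tau>}" for t
    using has_integral_linear[OF H1_FTC[OF x that] bounded_linear_inner_left[of v]]
    by (simp add: g_def o_def inner_diff_left integral_unique)
  have G: "(\<lambda>t. integral {0..t} g) \<in> L2 \<tau>"
    by (intro continuous_on_imp_L2 indefinite_integral_continuous_1 integrable_on_lebesgue_on L2_imp_integrable g) simp
  have "(LINT t|lebesgue_on {0..\<tau>}. derivative_on \<tau> \<phi> t *\<^sub>R x t) \<bullet> v
      = (LINT t|lebesgue_on {0..\<tau>}. derivative_on \<tau> \<phi> t * (x t \<bullet> v))"
    using integral_inner_left[OF L2_integrable_scaleR[OF d H1_imp_L2[OF x]], of v] by simp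
  also have "\<dots> = (LINT t|lebesgue_on {0..\<tau>}. (x 0 \<bullet> v) * derivative_on \<tau> \<phi> t + derivative_on \<tau> \<phi> t * integral {0..t} g)"
    by (intro Bochner_Integration.integral_cong refl) (subst xg, simp_all add: algebra_simps)
  also have "\<dots> = (x 0 \<bullet> v) * (LINT t|lebesgue_on {0..\<tau>}. derivative_on \<tau> \<phi> t)
      + (LINT t|lebesgue_on {0..\<tau>}. derivative_on \<tau> \<phi> t * integral {0..t} g)"
    using L2_imp_integrable[OF d] L2_integrable_scaleR[OF d G] by simp
  also have "(LINT t|lebesgue_on {0..\<tau>}. derivative_on \<tau> \<phi> t) = 0"
    by (rule H10_lebesgue_integral_derivative[OF \<phi>])
  also have "(LINT t|lebesgue_on {0..\<tau>}. derivative_on \<tau> \<phi> t * integral {0..t} g)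
      = - (LINT t|lebesgue_on {0..\<tau>}. \<phi> t * g t)"
    by (rule integral_derivative_times_primitive[OF \<phi> L2_imp_integrable[OF g]])
  finally show "synthesis_d \<tau> x \<phi> \<bullet> v = synthesis \<tau> (derivative_on \<tau> x) \<phi> \<bullet> v"
    by (simp add: synthesis_d_def synthesis_inner[OF dx \<phi>] g_def)
qed

lemma synthesis_AE_cong:
  assumes "f \<in> L2 \<tau>" "\<phi> \<in> H10 \<tau>" and eq: "AE t in lebesgue_on {0..\<tau>}. f t = g t"
  shows "synthesis \<tau> f \<phi> = synthesis \<tau> g \<phi>"
  unfolding synthesis_def
proof (rule integral_cong_AE)
  show "AE t in lebesgue_on {0..\<tau>}. \<phi> t *\<^sub>R f t = \<phi> t *\<^sub>R g t"
    using eq by eventually_elim simp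
qed (intro borel_measurable_scaleR L2_borel_measurable[OF H10_imp_L2[OF assms(2)]]
    L2_borel_measurable[OF assms(1)] L2_borel_measurable[OF L2_AE_cong[OF assms(1) eq]])+

text \<open>
  The defining equation of the adjoint says that \<open>S\<^sup>* v\<close> represents \<open>\<phi> \<mapsto> S \<phi> \<bullet> v = \<integral> \<phi> (f \<bullet> v)\<close>, and
  representing elements are unique.
\<close>

lemma H10_adjoint_synthesis:
  assumes "\<tau> > 0" "f \<in> L2 \<tau>"
  shows "H10_adjoint \<tau> (synthesis \<tau> f) v = dirichlet_solution \<tau> (\<lambda>t. f t \<bullet> v)"
proof -
  have g: "integrable (lebesgue_on {0..\<tau>}) (\<lambda>t. f t \<bullet> v)"
    by (intro L2_imp_integrable L2_inner assms)
  note \<psi> = dirichlet_solution(1)[OF assms(1) g]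
  have inner: "synthesis \<tau> f \<phi> \<bullet> v = H10_inner \<tau> \<phi> (dirichlet_solution \<tau> (\<lambda>t. f t \<bullet> v))" if "\<phi> \<in> H10 \<tau>" for \<phi>
    using synthesis_inner[OF assms(2) that] H10_inner_dirichlet_solution[OF assms(1) g that] by simp
  show ?thesis unfolding H10_adjoint_def
  proof (rule the_equality)
    show "dirichlet_solution \<tau> (\<lambda>t. f t \<bullet> v) \<in> H10 \<tau> \<and>
      (\<forall>\<phi>\<in>H10 \<tau>. synthesis \<tau> f \<phi> \<bullet> v = H10_inner \<tau> \<phi> (dirichlet_solution \<tau> (\<lambda>t. f t \<bullet> v)))"
      using \<psi> inner by blast
  next
    fix \<psi>' assume "\<psi>' \<in> H10 \<tau> \<and> (\<forall>\<phi>\<in>H10 \<tau>. synthesis \<tau> f \<phi> \<bullet> v = H10_inner \<tau> \<phi> \<psi>')"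
    then show "\<psi>' = dirichlet_solution \<tau> (\<lambda>t. f t \<bullet> v)"
      using inner by (intro H10_eqI[OF assms(1) _ \<psi>]) auto
  qed
qed

lemma H10_adjoint_synthesis_inner:
  assumes "\<tau> > 0" "f \<in> L2 \<tau>"
  shows "H10_adjoint \<tau> (synthesis \<tau> f) v \<in> H10 \<tau>"
    and "\<phi> \<in> H10 \<tau> \<Longrightarrow> H10_inner \<tau> \<phi> (H10_adjoint \<tau> (synthesis \<tau> f) v) = synthesis \<tau> f \<phi> \<bullet> v"
  using dirichlet_solution(1)[OF assms(1)] H10_inner_dirichlet_solution[OF assms(1)]
    L2_imp_integrable[OF L2_inner[OF assms(2)]] synthesis_inner[OF assms(2)]
  by (auto simp: H10_adjoint_synthesis[OF assms])

lemma H10_adjoint_synthesis_add_scale: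
  assumes "\<tau> > 0" "f \<in> L2 \<tau>"
  shows "H10_adjoint \<tau> (synthesis \<tau> f) (v + c *\<^sub>R w)
       = (\<lambda>t. H10_adjoint \<tau> (synthesis \<tau> f) v t + c * H10_adjoint \<tau> (synthesis \<tau> f) w t)"
proof (rule H10_eqI[OF assms(1)])
  note adj = H10_adjoint_synthesis_inner[OF assms]
  show "H10_adjoint \<tau> (synthesis \<tau> f) (v + c *\<^sub>R w) \<in> H10 \<tau>"
    "(\<lambda>t. H10_adjoint \<tau> (synthesis \<tau> f) v t + c * H10_adjoint \<tau> (synthesis \<tau> f) w t) \<in> H10 \<tau>"
    using adj(1) assms(1) by (auto intro: H10_add_scale)
  fix \<phi> assume \<phi>: "\<phi> \<in> H10 \<tau>"
  show "H10_inner \<tau> \<phi> (H10_adjoint \<tau> (synthesis \<tau> f) (v + c *\<^sub>R w)) =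
    H10_inner \<tau> \<phi> (\<lambda>t. H10_adjoint \<tau> (synthesis \<tau> f) v t + c * H10_adjoint \<tau> (synthesis \<tau> f) w t)"
    unfolding H10_inner_add_scale[OF assms(1) \<phi> adj(1) adj(1)] adj(2)[OF \<phi>]
    by (simp add: inner_add_right)
qed

text \<open>
  The matrix of \<open>T S\<^sup>*\<close> is defined through its values on unit vectors. It acts as \<open>T S\<^sup>*\<close> on all
  vectors because \<open>T\<close> and \<open>S\<^sup>*\<close> are linear.
\<close>

lemma mult_adjoint_synthesis_vector:
  assumes "\<tau> > 0" "f \<in> L2 \<tau>" "g \<in> L2 \<tau>"
  shows "mult_adjoint \<tau> (synthesis \<tau> g) (synthesis \<tau> f) *v v
       = synthesis \<tau> g (H10_adjoint \<tau> (synthesis \<tau> f) v)"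
proof -
  have eq: "synthesis \<tau> g (H10_adjoint \<tau> (synthesis \<tau> f) (v + c *\<^sub>R w))
     = synthesis \<tau> g (H10_adjoint \<tau> (synthesis \<tau> f) v) + c *\<^sub>R synthesis \<tau> g (H10_adjoint \<tau> (synthesis \<tau> f) w)" for v w c
    using assms by (simp add: H10_adjoint_synthesis_add_scale synthesis_add_scale H10_adjoint_synthesis_inner(1))
  have "linear (\<lambda>v. synthesis \<tau> g (H10_adjoint \<tau> (synthesis \<tau> f) v))"
  proof (rule linearI)
    show "synthesis \<tau> g (H10_adjoint \<tau> (synthesis \<tau> f) (v + w))
      = synthesis \<tau> g (H10_adjoint \<tau> (synthesis \<tau> f) v) + synthesis \<tau> g (H10_adjoint \<tau> (synthesis \<tau> f) w)" for v w
      using eq[of v 1 w] by simp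
    from this[of 0 0] have "synthesis \<tau> g (H10_adjoint \<tau> (synthesis \<tau> f) 0) = 0"
      by simp
    then show "synthesis \<tau> g (H10_adjoint \<tau> (synthesis \<tau> f) (c *\<^sub>R w))
      = c *\<^sub>R synthesis \<tau> g (H10_adjoint \<tau> (synthesis \<tau> f) w)" for w c
      using eq[of 0 c w] by simp
  qed
  then show ?thesis unfolding mult_adjoint_def
    by (intro matrix_works) (simp add: linear_matrix_vector_mul_eq)
qed

lemma matrix_inv_right:
  assumes "invertible A"
  shows "A ** matrix_inv A = mat 1"
  using assms unfolding invertible_def matrix_inv_def by (rule someI2_ex) auto

text \<open>
  The range of \<open>S S\<^sup>*\<close> is contained in that of \<open>S\<close>, which gives one direction. For the other,
  \<open>S S\<^sup>* v = 0\<close> implies \<open>\<parallel>S\<^sup>* v\<parallel>\<^sup>2 = S S\<^sup>* v \<bullet> v = 0\<close>, so \<open>S \<phi> \<bullet> v = 0\<close> for all \<open>\<phi>\<close>; choosing \<open>\<phi>\<close> with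
  \<open>S \<phi> = v\<close> yields \<open>v = 0\<close>.
\<close>

theorem surj_synthesis_iff_invertible:
  fixes f :: "real \<Rightarrow> real ^ 'k"
  assumes "\<tau> > 0" "f \<in> L2 \<tau>"
  shows "synthesis \<tau> f ` H10 \<tau> = UNIV \<longleftrightarrow> invertible (mult_adjoint \<tau> (synthesis \<tau> f) (synthesis \<tau> f))"
    (is "?surj \<longleftrightarrow> invertible ?G")
proof
  note adj = H10_adjoint_synthesis_inner[OF assms] and Gv = mult_adjoint_synthesis_vector[OF assms assms(2)]
  assume surj: ?surj
  have "v = 0" if "?G *v v = 0" for v
  proof -
    let ?\<psi> = "H10_adjoint \<tau> (synthesis \<tau> f) v"
    have "H10_inner \<tau> ?\<psi> ?\<psi> = (?G *v v) \<bullet> v" using adj(2)[OF adj(1)] Gv by simp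
    then have \<psi>0: "?\<psi> = (\<lambda>t. 0)" using that by (intro H10_inner_eq_0_imp[OF adj(1)]) simp
    obtain \<phi> where \<phi>: "\<phi> \<in> H10 \<tau>" "synthesis \<tau> f \<phi> = v" using surj by (metis UNIV_I imageE)
    have "v \<bullet> v = H10_inner \<tau> \<phi> (\<lambda>t. 0)" using adj(2)[OF \<phi>(1), of v] \<phi>(2) \<psi>0 by simp
    also have "\<dots> = 0"
    proof -
      have "(\<lambda>t. 0) \<in> H10 \<tau>" using adj(1)[of v] \<psi>0 by simp
      from H10_inner_add_scale[OF assms(1) \<phi>(1) this this, of 1] show ?thesis by simp
    qed
    finally show "v = 0" by simp
  qed
  then have "inj ((*v) ?G)" by (subst linear_injective_0) auto
  then show "invertible ?G"
    by (simp add: invertible_left_inverse matrix_left_invertible_injective)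
next
  note adj = H10_adjoint_synthesis_inner[OF assms] and Gv = mult_adjoint_synthesis_vector[OF assms assms(2)]
  assume "invertible ?G"
  then have "?G *v (matrix_inv ?G *v v) = v" for v
    by (simp add: matrix_vector_mul_assoc matrix_inv_right)
  then have "v \<in> synthesis \<tau> f ` H10 \<tau>" for v
    unfolding Gv using adj(1)[of "matrix_inv ?G *v v"] by (intro image_eqI[of v]) auto
  then show ?surj by auto
qed

text \<open>
  A proper subspace has a nonzero orthogonal vector \<open>v\<close>. Orthogonality to the range of the synthesis
  operator means that \<open>f \<bullet> v\<close> integrates to zero against every test function.
\<close>

lemma not_surj_synthesis_imp:
  fixes f :: "real \<Rightarrow> real ^ 'k"
  assumes "\<tau> > 0" "f \<in> L2 \<tau>" "synthesis \<tau> f ` H10 \<tau> \<noteq> UNIV"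
  obtains v where "v \<noteq> 0" "AE t in lebesgue_on {0..\<tau>}. f t \<bullet> v = 0"
proof -
  let ?R = "synthesis \<tau> f ` H10 \<tau>"
  have "subspace ?R"
  proof (rule subspaceI)
    have z: "(\<lambda>t. 0) \<in> H10 \<tau>"
      using H10_add_scale[OF assms(1) H10_adjoint_synthesis_inner(1)[OF assms(1,2)]
        H10_adjoint_synthesis_inner(1)[OF assms(1,2)], of 0 "-1" 0] by simp
    show zero: "0 \<in> ?R" by (rule image_eqI[OF _ z]) (simp add: synthesis_def)
    have lin: "y + c *\<^sub>R z \<in> ?R" if yz: "y \<in> ?R" "z \<in> ?R" for y z c
    proof -
      obtain \<phi> \<psi> where H: "\<phi> \<in> H10 \<tau>" "\<psi> \<in> H10 \<tau>" and yz: "y = synthesis \<tau> f \<phi>" "z = synthesis \<tau> f \<psi>"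
        using yz by blast
      show ?thesis unfolding yz synthesis_add_scale[OF assms(2) H, symmetric]
        by (intro imageI H10_add_scale assms(1) H)
    qed
    show "y + z \<in> ?R" if "y \<in> ?R" "z \<in> ?R" for y z using lin[OF that, of 1] by simp
    show "c *\<^sub>R z \<in> ?R" if "z \<in> ?R" for c z using lin[OF zero that, of c] by simp
  qed
  then have "span ?R = ?R" by (simp only: span_eq_iff)
  with assms(3) have "span ?R \<noteq> UNIV" by metis
  then have strict: "span ?R \<subset> span UNIV" unfolding span_UNIV by (rule psubsetI[OF subset_UNIV])
  obtain v where v: "v \<noteq> 0" "\<forall>y\<in>span ?R. orthogonal v y"
    using orthogonal_to_subspace_exists_gen[OF strict] by metis
  have "AE t in lebesgue_on {0..\<tau>}. f t \<bullet> v = 0"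
  proof (rule fundamental_lemma_H10[OF assms(1)])
    show "integrable (lebesgue_on {0..\<tau>}) (\<lambda>t. f t \<bullet> v)" by (intro L2_imp_integrable L2_inner assms(2))
    fix \<phi> assume "\<phi> \<in> H10 \<tau>"
    then show "(LINT t|lebesgue_on {0..\<tau>}. \<phi> t * (f t \<bullet> v)) = 0"
      using bspec[OF v(2), of "synthesis \<tau> f \<phi>"] synthesis_inner[OF assms(2), of \<phi> v]
      by (simp add: span_base orthogonal_def inner_commute)
  qed
  with v(1) that show ?thesis by blast
qed

section \<open>Block vectors and block matrices\<close>

lemma stack_nth [simp]: "stack v w $ Inl i = v $ i" "stack v w $ Inr j = w $ j"
  by (simp_all add: stack_def)

lemma vec_sum_eqI:
  fixes v w :: "'a ^ ('n::finite + 'm::finite)"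
  assumes "\<And>i. v $ Inl i = w $ Inl i" "\<And>j. v $ Inr j = w $ Inr j"
  shows "v = w"
proof (subst vec_eq_iff, rule allI)
  show "v $ i = w $ i" for i using assms by (cases i) auto
qed

lemma beside_nth [simp]: "beside P Q $ i = stack (P $ i) (Q $ i)"
  by (simp add: beside_def)

lemma sum_UNIV_Plus: "sum h (UNIV :: ('n::finite + 'm::finite) set) = (\<Sum>i\<in>UNIV. h (Inl i)) + (\<Sum>j\<in>UNIV. h (Inr j))"
  using sum.Plus[of "UNIV :: 'n set" "UNIV :: 'm set" h] by simp

lemma stack_inner:
  fixes v v' :: "real ^ 'n" and w w' :: "real ^ 'm"
  shows "stack v w \<bullet> stack v' w' = v \<bullet> v' + w \<bullet> w'"
  by (simp add: inner_vec_def sum_UNIV_Plus)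

lemma beside_vector:
  fixes A :: "real ^ 'n ^ 'k" and B :: "real ^ 'm ^ 'k"
  shows "beside A B *v stack v w = A *v v + B *v w"
  by (simp add: vec_eq_iff matrix_vector_mult_def sum_UNIV_Plus)

lemma beside_eq_iff: "beside A B = beside A' B' \<longleftrightarrow> A = A' \<and> B = B'"
proof
  assume eq: "beside A B = beside A' B'"
  then have "stack (A $ i) (B $ i) = stack (A' $ i) (B' $ i)" for i by (metis beside_nth)
  then show "A = A' \<and> B = B'" by (simp add: vec_eq_iff) (metis stack_nth)
qed simp

lemma stack_split: obtains v w where "z = stack v w"
proof
  show "z = stack (\<chi> i. z $ Inl i) (\<chi> j. z $ Inr j)" by (rule vec_sum_eqI) auto
qed

lemma L2_stack:
  fixes x :: "real \<Rightarrow> real ^ 'n" and u :: "real \<Rightarrow> real ^ 'm"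
  assumes "x \<in> L2 \<tau>" "u \<in> L2 \<tau>"
  shows "(\<lambda>t. stack (x t) (u t)) \<in> L2 \<tau>"
proof -
  have h: "linear (\<lambda>v :: real ^ 'n. stack v (0 :: real ^ 'm))"
    "linear (\<lambda>w :: real ^ 'm. stack (0 :: real ^ 'n) w)"
    by (auto intro!: linearI vec_sum_eqI)
  have "(\<lambda>t. stack (x t) 0 + stack 0 (u t)) \<in> L2 \<tau>"
    by (rule L2_add[OF L2_linear[OF assms(1) h(1)] L2_linear[OF assms(2) h(2)]])
  moreover have "stack (x t) 0 + stack 0 (u t) = stack (x t) (u t)" for t
    by (rule vec_sum_eqI) auto
  ultimately show ?thesis by simp
qed

lemma synthesis_stack:
  fixes x :: "real \<Rightarrow> real ^ 'n" and u :: "real \<Rightarrow> real ^ 'm"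
  assumes "x \<in> L2 \<tau>" "u \<in> L2 \<tau>" "\<phi> \<in> H10 \<tau>"
  shows "synthesis \<tau> (\<lambda>t. stack (x t) (u t)) \<phi> = stack (synthesis \<tau> x \<phi>) (synthesis \<tau> u \<phi>)"
proof (rule vec_sum_eqI)
  note f = L2_stack[OF assms(1,2)]
  have comp: "synthesis \<tau> h \<phi> $ i = (LINT t|lebesgue_on {0..\<tau>}. \<phi> t * h t $ i)" if "h \<in> L2 \<tau>" for h :: "real \<Rightarrow> real ^ 'k" and i
    using synthesis_inner[OF that assms(3), of "axis i 1"] by (simp add: inner_axis)
  show "synthesis \<tau> (\<lambda>t. stack (x t) (u t)) \<phi> $ Inl i = stack (synthesis \<tau> x \<phi>) (synthesis \<tau> u \<phi>) $ Inl i" for i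
    by (simp add: comp[OF f] comp[OF assms(1)])
  show "synthesis \<tau> (\<lambda>t. stack (x t) (u t)) \<phi> $ Inr j = stack (synthesis \<tau> x \<phi>) (synthesis \<tau> u \<phi>) $ Inr j" for j
    by (simp add: comp[OF f] comp[OF assms(2)])
qed

lemma mult_adjoint_nth:
  assumes "\<tau> > 0" "f \<in> L2 \<tau>"
  shows "mult_adjoint \<tau> T (synthesis \<tau> f) $ i $ j = T (dirichlet_solution \<tau> (\<lambda>t. f t $ j)) $ i"
  by (simp add: mult_adjoint_def matrix_def H10_adjoint_synthesis[OF assms] inner_axis)

text \<open>
  A column of \<open>T S\<^sup>*\<close> depends on one component of \<open>f\<close> only, so the blocks can be read off entry by
  entry.
\<close>

lemma mult_adjoint_stack:
  assumes "\<tau> > 0" "x \<in> L2 \<tau>" "u \<in> L2 \<tau>"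
  shows "beside (mult_adjoint \<tau> T (synthesis \<tau> x)) (mult_adjoint \<tau> T (synthesis \<tau> u))
       = mult_adjoint \<tau> T (synthesis \<tau> (\<lambda>t. stack (x t) (u t)))"
proof (subst vec_eq_iff, rule allI, rule vec_sum_eqI)
qed (simp_all add: mult_adjoint_nth assms L2_stack)

lemma block_matrix_mult_adjoint:
  fixes x :: "real \<Rightarrow> real ^ 'n" and u :: "real \<Rightarrow> real ^ 'm"
  assumes "\<tau> > 0" "x \<in> L2 \<tau>" "u \<in> L2 \<tau>"
  defines "S \<equiv> synthesis \<tau> (\<lambda>t. stack (x t) (u t))"
  shows "block_matrix (mult_adjoint \<tau> (synthesis \<tau> x) (synthesis \<tau> x)) (mult_adjoint \<tau> (synthesis \<tau> x) (synthesis \<tau> u))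
      (mult_adjoint \<tau> (synthesis \<tau> u) (synthesis \<tau> x)) (mult_adjoint \<tau> (synthesis \<tau> u) (synthesis \<tau> u))
    = mult_adjoint \<tau> S S"
proof -
  note f = L2_stack[OF assms(2,3)]
  have \<psi>: "dirichlet_solution \<tau> (\<lambda>t. stack (x t) (u t) $ j) \<in> H10 \<tau>" for j
    using dirichlet_solution(1)[OF assms(1) L2_imp_integrable[OF L2_inner[OF f]], of "axis j 1"] by (simp add: inner_axis)
  show ?thesis
    unfolding block_matrix_def mult_adjoint_stack[OF assms(1-3)] S_def
    by (rule vec_sum_eqI; subst vec_eq_iff) (simp_all add: mult_adjoint_nth[OF assms(1) f] synthesis_stack[OF assms(2,3) \<psi>])
qed

lemma mult_adjoint_matrix_mult:
  fixes M :: "real ^ 'k ^ 'l"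
  assumes "\<tau> > 0" "f \<in> L2 \<tau>" and T: "\<And>\<phi>. \<phi> \<in> H10 \<tau> \<Longrightarrow> T \<phi> = M *v synthesis \<tau> f \<phi>"
  shows "mult_adjoint \<tau> T (synthesis \<tau> f) = M ** mult_adjoint \<tau> (synthesis \<tau> f) (synthesis \<tau> f)"
proof -
  have "dirichlet_solution \<tau> (\<lambda>t. f t $ j) \<in> H10 \<tau>" for j
    using dirichlet_solution(1)[OF assms(1) L2_imp_integrable[OF L2_inner[OF assms(2)]], of "axis j 1"] by (simp add: inner_axis)
  then show ?thesis
    by (simp add: vec_eq_iff mult_adjoint_nth[OF assms(1,2)] T matrix_matrix_mult_def matrix_vector_mult_def)
qed

section \<open>Identification of the system\<close>

lemma satisfies_system_imp_synthesis_d: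
  fixes x :: "real \<Rightarrow> real ^ 'n" and u :: "real \<Rightarrow> real ^ 'm"
  assumes "x \<in> H1 \<tau>" "u \<in> L2 \<tau>" "satisfies_system \<tau> x u A B" "\<phi> \<in> H10 \<tau>"
  shows "synthesis_d \<tau> x \<phi> = beside A B *v synthesis \<tau> (\<lambda>t. stack (x t) (u t)) \<phi>"
proof -
  have "AE t in lebesgue_on {0..\<tau>}. derivative_on \<tau> x t = beside A B *v stack (x t) (u t)"
    using assms(3) by (simp add: satisfies_system_def beside_vector)
  then have "synthesis_d \<tau> x \<phi> = synthesis \<tau> (\<lambda>t. beside A B *v stack (x t) (u t)) \<phi>"
    using assms by (simp add: synthesis_d_eq_synthesis_derivative synthesis_AE_cong H1_derivative_L2)
  also have "\<dots> = beside A B *v synthesis \<tau> (\<lambda>t. stack (x t) (u t)) \<phi>"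
    by (rule synthesis_linear[OF matrix_vector_mul_linear L2_stack[OF H1_imp_L2[OF assms(1)] assms(2)] assms(4)])
  finally show ?thesis .
qed

text \<open>
  If \<open>S\<close> is onto, \<open>X\<^sub>d = [A B] S\<close> determines \<open>[A B]\<close>. Otherwise the data satisfy a linear relation
  \<open>f \<bullet> z = 0\<close> almost everywhere, and a matrix all of whose rows are \<open>z\<close> can be added to \<open>[A B]\<close>.
\<close>

lemma informative_iff_surj:
  fixes x :: "real \<Rightarrow> real ^ 'n" and u :: "real \<Rightarrow> real ^ 'm"
  assumes "\<tau> > 0" "x \<in> H1 \<tau>" "u \<in> L2 \<tau>" and sys: "satisfies_system \<tau> x u A B"
  defines "S \<equiv> synthesis \<tau> (\<lambda>t. stack (x t) (u t))"
  shows "informative_for_identification \<tau> x u A B \<longleftrightarrow> S ` H10 \<tau> = UNIV"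
proof
  assume inf: "informative_for_identification \<tau> x u A B"
  show "S ` H10 \<tau> = UNIV"
  proof (rule ccontr)
    assume "S ` H10 \<tau> \<noteq> UNIV"
    then obtain z where z: "z \<noteq> 0" "AE t in lebesgue_on {0..\<tau>}. stack (x t) (u t) \<bullet> z = 0"
      using not_surj_synthesis_imp[OF assms(1) L2_stack[OF H1_imp_L2[OF assms(2)] assms(3)]]
      unfolding S_def by metis
    obtain v w where vw: "z = stack v w" by (rule stack_split)
    define P :: "real ^ 'n ^ 'n" where "P = (\<chi> i. v)"
    define Q :: "real ^ 'm ^ 'n" where "Q = (\<chi> i. w)"
    have PQ: "P *v a + Q *v b = (\<chi> i. stack a b \<bullet> z)" for a b
      by (simp add: P_def Q_def vw stack_inner vec_eq_iff matrix_vector_mul_component inner_commute)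
    have "satisfies_system \<tau> x u (A + P) (B + Q)"
      using sys z(2) unfolding satisfies_system_def
    proof eventually_elim
      case (elim t)
      have "(A + P) *v x t + (B + Q) *v u t = A *v x t + B *v u t + (P *v x t + Q *v u t)"
        by (simp add: matrix_vector_mult_add_rdistrib)
      also have "P *v x t + Q *v u t = 0" unfolding PQ using elim by (simp add: vec_eq_iff)
      finally show ?case using elim by simp
    qed
    then have "(A + P, B + Q) \<in> consistent_systems \<tau> x u"
      by (simp add: consistent_systems_def)
    then have "P = 0" "Q = 0"
      using inf by (simp_all add: informative_for_identification_def)
    then have "v = 0" "w = 0" by (auto simp: P_def Q_def vec_eq_iff)
    then have "z = 0" unfolding vw by (intro vec_sum_eqI) auto
    with z(1) show False by simp
  qed
next
  assume surj: "S ` H10 \<tau> = UNIV"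
  have uniq: "A' = A \<and> B' = B" if "satisfies_system \<tau> x u A' B'" for A' B'
  proof -
    have "beside A' B' *v z = beside A B *v z" for z
    proof -
      obtain \<phi> where "\<phi> \<in> H10 \<tau>" "z = S \<phi>" using surj by (metis UNIV_I imageE)
      then show ?thesis
        using satisfies_system_imp_synthesis_d[OF assms(2,3) that, of \<phi>]
          satisfies_system_imp_synthesis_d[OF assms(2,3) sys, of \<phi>] by (simp add: S_def)
    qed
    then have "beside A' B' = beside A B" by (simp add: matrix_eq)
    then show ?thesis by (simp add: beside_eq_iff)
  qed
  show "informative_for_identification \<tau> x u A B"
    unfolding informative_for_identification_def
  proof (intro equalityI subsetI)
    fix p assume "p \<in> consistent_systems \<tau> x u"
    then obtain A' B' where "p = (A', B')" "satisfies_system \<tau> x u A' B'"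
      by (cases p) (simp add: consistent_systems_def)
    then show "p \<in> {(A, B)}" using uniq[of A' B'] by simp
  qed (simp add: consistent_systems_def sys)
qed

theorem proposition3p1:
  fixes \<tau> :: real
    and x :: "real \<Rightarrow> real ^ 'n" and u :: "real \<Rightarrow> real ^ 'm"
    and A\<^sub>s :: "real ^ 'n ^ 'n" and B\<^sub>s :: "real ^ 'm ^ 'n"
    and X\<^sub>d X :: "(real \<Rightarrow> real) \<Rightarrow> real ^ 'n" and U :: "(real \<Rightarrow> real) \<Rightarrow> real ^ 'm"
    and G :: "real ^ ('n + 'm) ^ ('n + 'm)"
  assumes "\<tau> > 0"
    and "(x, u) \<in> data_space \<tau>"
    and "satisfies_system \<tau> x u A\<^sub>s B\<^sub>s"
  defines "X\<^sub>d \<equiv> synthesis_d \<tau> x" and "X \<equiv> synthesis \<tau> x" and "U \<equiv> synthesis \<tau> u"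
  defines "G \<equiv> block_matrix (mult_adjoint \<tau> X X) (mult_adjoint \<tau> X U)
                            (mult_adjoint \<tau> U X) (mult_adjoint \<tau> U U)"
  shows "(informative_for_identification \<tau> x u A\<^sub>s B\<^sub>s \<longleftrightarrow>
            (\<lambda>\<phi>. stack (X \<phi>) (U \<phi>)) ` H10 \<tau> = UNIV) \<and>
         ((\<lambda>\<phi>. stack (X \<phi>) (U \<phi>)) ` H10 \<tau> = UNIV \<longleftrightarrow> invertible G) \<and>
         (invertible G \<longrightarrow>
            beside A\<^sub>s B\<^sub>s = beside (mult_adjoint \<tau> X\<^sub>d X) (mult_adjoint \<tau> X\<^sub>d U) ** matrix_inv G)"
proof -
  define S where "S = synthesis \<tau> (\<lambda>t. stack (x t) (u t))"
  have x: "x \<in> H1 \<tau>" and u: "u \<in> L2 \<tau>" using assms(2) by (auto simp: data_space_def)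
  note xL = H1_imp_L2[OF x] and fL = L2_stack[OF H1_imp_L2[OF x] u]
  have ran: "(\<lambda>\<phi>. stack (X \<phi>) (U \<phi>)) ` H10 \<tau> = S ` H10 \<tau>"
    unfolding X_def U_def S_def by (intro image_cong) (simp_all add: synthesis_stack[OF xL u])
  have G: "G = mult_adjoint \<tau> S S"
    unfolding G_def X_def U_def S_def by (rule block_matrix_mult_adjoint[OF assms(1) xL u])
  have "beside (mult_adjoint \<tau> X\<^sub>d X) (mult_adjoint \<tau> X\<^sub>d U) = mult_adjoint \<tau> X\<^sub>d S"
    unfolding X_def U_def S_def by (rule mult_adjoint_stack[OF assms(1) xL u])
  also have "\<dots> = beside A\<^sub>s B\<^sub>s ** G"
    unfolding G S_def X\<^sub>d_def
    by (intro mult_adjoint_matrix_mult[OF assms(1) fL] satisfies_system_imp_synthesis_d[OF x u assms(3)])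
  finally have Xd: "beside (mult_adjoint \<tau> X\<^sub>d X) (mult_adjoint \<tau> X\<^sub>d U) = beside A\<^sub>s B\<^sub>s ** G" .
  have "beside A\<^sub>s B\<^sub>s = beside A\<^sub>s B\<^sub>s ** G ** matrix_inv G" if "invertible G"
    using that by (metis matrix_inv_right matrix_mul_assoc matrix_mul_rid)
  then show ?thesis
    unfolding ran Xd G
    using informative_iff_surj[OF assms(1) x u assms(3)] surj_synthesis_iff_invertible[OF assms(1) fL]
    unfolding S_def by blast
qed

end
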